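(* Let $f:I\to\mathbb{R}$ be a positive smooth function on an interval $I$, and let $\Omega=\{(x,y)\in\mathbb{R}^n\times I:\ |x|<f(y)\}$ be the rotational domain in $\mathbb{R}^{n+1}$ bounded by the hypersurface of revolution $\{|x|=f(y)\}$. Let $J\subset I$ be a subinterval with $f'\ge 0$ on $J$ and let $\Omega'=\{(x,y)\in\mathbb{R}^n\times J:\ |x|\le f(y)\}$ be the corresponding piece of $\Omega$. If $\Sigma\subset\Omega'$ is a minimal hypersurface with free boundary on $\{|x|=f(y)\}$, then $\Sigma$ is a flat disk $\{(x,t):|x|\le f(t)\}$ for some $t\in J$, and its boundary $\partial\Sigma$ lies at a height $t$ with $f'(t)=0$.
   Context: $\Sigma$ is a compact, connected, smooth immersed hypersurface of dimension $n$ in $\mathbb{R}^{n+1}=\mathbb{R}^n\times\mathbb{R}$, with boundary $\partial\Sigma\subset\{(x,y):\ y\in J,\ |x|=f(y)\}$. Free boundary means that $\Sigma$ meets the hypersurface $\{|x|=f(y)\}$ orthogonally along $\partial\Sigma$, i.e. the outward unit conormal of $\partial\Sigma$ in $\Sigma$ equals the outward unit normal $\nabla F/|\nabla F|$ of $\Omega$, where $F(x,y)=|x|^2-f(y)^2+1$. *)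

theory Defs
  imports "HOL-Analysis.Analysis"
begin

(* All derivatives are taken within the domain S.  S is always a nondegenerate interval or a
   relatively open subset of a closed half-space, where such derivatives are unique; at the
   boundary of S they are the one-sided ones.  Ck_on k S f: f is k times continuously
   differentiable on S, up to and including the boundary points that belong to S. *)

primrec Ck_on :: "nat \<Rightarrow> 'a::real_normed_vector set \<Rightarrow> ('a \<Rightarrow> 'b::real_normed_vector) \<Rightarrow> bool"
  where
    "Ck_on 0 S f \<longleftrightarrow> continuous_on S f"
  | "Ck_on (Suc k) S f \<longleftrightarrow>
       f differentiable_on S \<and> (\<forall>v. Ck_on k S (\<lambda>x. frechet_derivative f (at x within S) v))"

definition smooth_on :: "'a::real_normed_vector set \<Rightarrow> ('a \<Rightarrow> 'b::real_normed_vector) \<Rightarrow> bool"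
  where "smooth_on S f \<longleftrightarrow> (\<forall>k. Ck_on k S f)"

definition gradient_within :: "('a::real_inner \<Rightarrow> real) \<Rightarrow> 'a set \<Rightarrow> 'a \<Rightarrow> 'a"
  where "gradient_within F S z = (THE D. (F has_derivative (\<lambda>h. D \<bullet> h)) (at z within S))"


(* An arbitrary but fixed coordinate of R^n, used to single out the model half-space. *)

definition bd_coord :: "'n::finite"
  where "bd_coord = (SOME k. True)"

definition half_space :: "(real ^ 'n) set"
  where "half_space = {u. 0 \<le> u $ bd_coord}"

(* A chart is a pair (U, c) of a coordinate domain and a coordinate map; the values of c
   outside U are irrelevant. *)

type_synonym ('m, 'n) chart = "'m set \<times> ('m \<Rightarrow> real ^ 'n)"

definition is_chart :: "'m topology \<Rightarrow> ('m, 'n::finite) chart \<Rightarrow> bool"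
  where "is_chart M = (\<lambda>(U, c).
    openin M U \<and> openin (top_of_set half_space) (c ` U) \<and>
    homeomorphic_map (subtopology M U) (top_of_set (c ` U)) c)"

definition smooth_manifold_with_boundary ::
    "'m topology \<Rightarrow> ('m, 'n::finite) chart set \<Rightarrow> bool"
  where "smooth_manifold_with_boundary M A \<longleftrightarrow>
    Hausdorff_space M \<and> second_countable M \<and>
    (\<forall>C\<in>A. is_chart M C) \<and> (\<Union>(U, c)\<in>A. U) = topspace M \<and>
    (\<forall>(U, c)\<in>A. \<forall>(V, d)\<in>A. smooth_on (c ` (U \<inter> V)) (d \<circ> inv_into U c))"

definition manifold_boundary :: "('m, 'n::finite) chart set \<Rightarrow> 'm set"
  where "manifold_boundary A = {p. \<exists>(U, c)\<in>A. p \<in> U \<and> c p $ bd_coord = 0}"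


definition local_param :: "('m \<Rightarrow> 'b) \<Rightarrow> ('m, 'n::finite) chart \<Rightarrow> real ^ 'n \<Rightarrow> 'b"
  where "local_param \<phi> = (\<lambda>(U, c). \<phi> \<circ> inv_into U c)"

definition chart_differential ::
    "('m \<Rightarrow> 'b::real_normed_vector) \<Rightarrow> ('m, 'n::finite) chart \<Rightarrow> 'm \<Rightarrow> real ^ 'n \<Rightarrow> 'b"
  where "chart_differential \<phi> = (\<lambda>(U, c) p.
    frechet_derivative (local_param \<phi> (U, c)) (at (c p) within c ` U))"

definition smooth_immersion ::
    "('m, 'n::finite) chart set \<Rightarrow> ('m \<Rightarrow> 'b::real_normed_vector) \<Rightarrow> bool"
  where "smooth_immersion A \<phi> \<longleftrightarrow>
    (\<forall>(U, c)\<in>A. smooth_on (c ` U) (local_param \<phi> (U, c)) \<and>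
       (\<forall>p\<in>U. inj (chart_differential \<phi> (U, c) p)))"


definition partial_within ::
    "(real ^ 'n) set \<Rightarrow> 'n \<Rightarrow> (real ^ 'n \<Rightarrow> 'b::real_normed_vector) \<Rightarrow> real ^ 'n \<Rightarrow> 'b"
  where "partial_within S i X u = frechet_derivative X (at u within S) (axis i 1)"

definition first_fundamental_form ::
    "(real ^ 'n) set \<Rightarrow> (real ^ 'n \<Rightarrow> 'b::real_inner) \<Rightarrow> real ^ 'n \<Rightarrow> real ^ 'n ^ 'n"
  where "first_fundamental_form S X u =
    (\<chi> i j. partial_within S i X u \<bullet> partial_within S j X u)"

definition second_fundamental_form ::
    "(real ^ 'n) set \<Rightarrow> (real ^ 'n \<Rightarrow> 'b::real_inner) \<Rightarrow> 'b \<Rightarrow> real ^ 'n \<Rightarrow> real ^ 'n ^ 'n"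
  where "second_fundamental_form S X N u =
    (\<chi> i j. partial_within S i (partial_within S j X) u \<bullet> N)"

definition mean_curvature ::
    "(real ^ 'n) set \<Rightarrow> (real ^ 'n \<Rightarrow> 'b::real_inner) \<Rightarrow> 'b \<Rightarrow> real ^ 'n \<Rightarrow> real"
  where "mean_curvature S X N u =
    trace (matrix_inv (first_fundamental_form S X u) ** second_fundamental_form S X N u)"

definition is_unit_normal ::
    "('m \<Rightarrow> 'b::real_inner) \<Rightarrow> ('m, 'n::finite) chart \<Rightarrow> 'm \<Rightarrow> 'b \<Rightarrow> bool"
  where "is_unit_normal \<phi> C p N \<longleftrightarrow>
    norm N = 1 \<and> (\<forall>v. N \<bullet> chart_differential \<phi> C p v = 0)"

(* No orientability is needed: replacing N by -N only changes the sign of the mean curvature. *)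

definition minimal_immersion ::
    "('m, 'n::finite) chart set \<Rightarrow> ('m \<Rightarrow> (real ^ 'n) \<times> real) \<Rightarrow> bool"
  where "minimal_immersion A \<phi> \<longleftrightarrow>
    (\<forall>(U, c)\<in>A. \<forall>p\<in>U. \<forall>N. is_unit_normal \<phi> (U, c) p N \<longrightarrow>
       mean_curvature (c ` U) (local_param \<phi> (U, c)) N (c p) = 0)"

(* In a boundary chart the tangent space of the boundary is the image of {w. w $ bd_coord = 0},
   and a tangent vector points outward iff its coordinate vector v leaves the half-space, that
   is, v $ bd_coord < 0. *)

definition is_outward_unit_conormal ::
    "('m, 'n::finite) chart set \<Rightarrow> ('m \<Rightarrow> 'b::real_inner) \<Rightarrow> 'm \<Rightarrow> 'b \<Rightarrow> bool"
  where "is_outward_unit_conormal A \<phi> p \<eta> \<longleftrightarrow>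
    (\<exists>(U, c)\<in>A. p \<in> U \<and> c p $ bd_coord = 0 \<and> norm \<eta> = 1 \<and>
       (\<exists>v. v $ bd_coord < 0 \<and> \<eta> = chart_differential \<phi> (U, c) p v) \<and>
       (\<forall>w. w $ bd_coord = 0 \<longrightarrow> \<eta> \<bullet> chart_differential \<phi> (U, c) p w = 0))"


definition revolution_piece :: "(real \<Rightarrow> real) \<Rightarrow> real set \<Rightarrow> ((real ^ 'n) \<times> real) set"
  where "revolution_piece f J = {(x, y). y \<in> J \<and> norm x \<le> f y}"

definition revolution_surface :: "(real \<Rightarrow> real) \<Rightarrow> real set \<Rightarrow> ((real ^ 'n) \<times> real) set"
  where "revolution_surface f J = {(x, y). y \<in> J \<and> norm x = f y}"

definition defining_function :: "(real \<Rightarrow> real) \<Rightarrow> (real ^ 'n) \<times> real \<Rightarrow> real"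
  where "defining_function f = (\<lambda>(x, y). (norm x)\<^sup>2 - (f y)\<^sup>2 + 1)"

definition domain_unit_normal ::
    "(real \<Rightarrow> real) \<Rightarrow> real set \<Rightarrow> (real ^ 'n) \<times> real \<Rightarrow> (real ^ 'n) \<times> real"
  where "domain_unit_normal f I z =
    (let D = gradient_within (defining_function f) (UNIV \<times> I) z in D /\<^sub>R norm D)"

definition free_boundary ::
    "(real \<Rightarrow> real) \<Rightarrow> real set \<Rightarrow> ('m, 'n::finite) chart set \<Rightarrow> ('m \<Rightarrow> (real ^ 'n) \<times> real) \<Rightarrow> bool"
  where "free_boundary f I A \<phi> \<longleftrightarrow>
    (\<forall>p\<in>manifold_boundary A. is_outward_unit_conormal A \<phi> p (domain_unit_normal f I (\<phi> p)))"

end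

theory Submission
  imports Defs
begin

text \<open>The height function is harmonic on a minimal hypersurface, and the free boundary condition
  together with \<open>f' \<ge> 0\<close> makes its outward conormal derivative nonpositive. By the Hopf lemma a
  maximum on the boundary would force a positive conormal derivative, so the strong maximum
  principle shows that the height is constant. The surface is then immersed in a horizontal
  hyperplane, and its projection is a local homeomorphism of a compact connected manifold onto a
  closed ball, hence a bijection; in particular it has a boundary point, where the conormal is
  horizontal and so \<open>f' = 0\<close>.\<close>

section \<open>The Hopf lemma\<close>

text \<open>No Laplace-Beltrami operator occurs. For a local parametrization \<open>X\<close>,
  minimality says that the trace of its second derivatives with respect to the induced metric is a
  tangent vector \<open>DX z b\<close>. Pairing with a constant vector \<open>a\<close> gives a
  linear elliptic equation for \<open>X z \<bullet> a\<close> with a drift and no zeroth-order term.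
  Its constants are controlled only on compact sets, so the Hopf lemma is always applied on a closed
  ball inside one chart. The conormal need not be the coordinate normal of a boundary chart. At a
  boundary maximum the derivatives tangent to the boundary vanish, so the derivatives along all
  outward vectors have the same sign. The immersion may a priori be many-to-one and its boundary
  empty; topology excludes both. Boundary points go to the sphere \<open>|x| = f t\<close> and
  interior points into the open ball, and this makes the projection open onto the closed ball even
  at boundary points, where invariance of domain does not apply directly.\<close>

lemma second_derivative_test:
  fixes u :: "'a::real_normed_vector \<Rightarrow> real"
  assumes S: "open S" "z \<in> S"
    and d1: "\<And>x. x \<in> S \<Longrightarrow> (u has_derivative u1 x) (at x)"
    and d2: "((\<lambda>x. u1 x v) has_derivative D) (at z)"
    and max: "\<And>x. x \<in> S \<Longrightarrow> u x \<le> u z"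
  shows "D v \<le> 0"
proof (rule ccontr)
  assume neg: "\<not> D v \<le> 0"
  obtain e where e: "e > 0" "ball z e \<subseteq> S"
    using S open_contains_ball by blast
  have u1z: "u1 z = (\<lambda>v. 0)"
    using differential_zero_maxmin[OF S(2,1) d1[OF S(2)]] max by blast
  have der1: "DERIV (\<lambda>t. u (z + t *\<^sub>R v)) t :> u1 (z + t *\<^sub>R v) v" if "z + t *\<^sub>R v \<in> S" for t
  proof -
    have "((\<lambda>t. z + t *\<^sub>R v) has_derivative (\<lambda>t. t *\<^sub>R v)) (at t)"
      by (auto intro!: derivative_eq_intros)
    from diff_chain_at[OF this d1[OF that]]
    have "((\<lambda>t. u (z + t *\<^sub>R v)) has_derivative (\<lambda>s. u1 (z + t *\<^sub>R v) (s *\<^sub>R v))) (at t)" 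
      unfolding o_def .
    moreover have "u1 (z + t *\<^sub>R v) (s *\<^sub>R v) = s * u1 (z + t *\<^sub>R v) v" for s
      using linear_scale[OF has_derivative_linear[OF d1[OF that]]] by simp
    ultimately show ?thesis
      by (simp add: has_field_derivative_def mult_commute_abs)
  qed
  have der2: "DERIV (\<lambda>t. u1 (z + t *\<^sub>R v) v) 0 :> D v"
  proof -
    have "((\<lambda>t. z + t *\<^sub>R v) has_derivative (\<lambda>t. t *\<^sub>R v)) (at 0)"
      by (auto intro!: derivative_eq_intros)
    moreover have "((\<lambda>x. u1 x v) has_derivative D) (at (z + 0 *\<^sub>R v))" using d2 by simp
    ultimately have "((\<lambda>t. u1 (z + t *\<^sub>R v) v) has_derivative (\<lambda>t. D (t *\<^sub>R v))) (at 0)" 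
      using diff_chain_at[of "\<lambda>t. z + t *\<^sub>R v" "\<lambda>t. t *\<^sub>R v" 0 "\<lambda>x. u1 x v" D]
      by (simp add: o_def)
    moreover have "D (s *\<^sub>R v) = s * D v" for s
      using linear_scale[OF has_derivative_linear[OF d2]] by simp
    ultimately show ?thesis
      by (simp add: has_field_derivative_def mult_commute_abs)
  qed
  \<comment> \<open>\<open>u1 z v = 0\<close> and a positive second derivative make the slope along
    the ray positive just after \<open>0\<close>, so \<open>u\<close> would exceed its maximum at
    \<open>z + T *\<^sub>R v\<close>.\<close>
  obtain d where d: "d > 0" "\<And>h. 0 < h \<Longrightarrow> h < d \<Longrightarrow> 0 < u1 (z + h *\<^sub>R v) v"
    using DERIV_pos_inc_right[OF der2] neg u1z by auto
  \<comment> \<open>Half of \<open>d\<close> keeps \<open>T\<close> strictly below it; the second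
    bound gives \<open>T * norm v < e\<close>, and the summand \<open>1\<close> covers
    \<open>v = 0\<close>.\<close>
  define T where "T = min (d/2) (e / (2 * (norm v + 1)))"
  have T: "T > 0" "T < d" using d e by (auto simp: T_def add_nonneg_pos)
  have "T * norm v \<le> e / (2 * (norm v + 1)) * norm v"
    by (rule mult_right_mono) (auto simp: T_def)
  also have "\<dots> < e"
  proof -
    have pos: "0 < 2 * (norm v + 1)" by (simp add: add_nonneg_pos)
    have "norm v < 2 * (norm v + 1)" by (smt (verit) norm_ge_zero)
    then have "e * norm v < e * (2 * (norm v + 1))" using e by simp
    then show ?thesis using pos by (simp add: pos_divide_less_eq)
  qed
  finally have Tv: "T * norm v < e" .
  have inS: "z + t *\<^sub>R v \<in> S" if "0 \<le> t" "t \<le> T" for t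
  proof -
    have "t * norm v \<le> T * norm v" using that by (intro mult_right_mono) auto
    then show ?thesis using e Tv that by (intro subsetD[OF e(2)]) (auto simp: dist_norm)
  qed
  have "u (z + 0 *\<^sub>R v) < u (z + T *\<^sub>R v)"
  proof (rule DERIV_pos_imp_increasing_open[where f = "\<lambda>t. u (z + t *\<^sub>R v)"])
    show "0 < T" by fact
    show "\<exists>y. DERIV (\<lambda>t. u (z + t *\<^sub>R v)) t :> y \<and> 0 < y" if "0 < t" "t < T" for t
      using der1[OF inS[of t]] d(2)[of t] that T by auto
    show "continuous_on {0..T} (\<lambda>t. u (z + t *\<^sub>R v))"
      using der1 inS by (intro continuous_at_imp_continuous_on ballI) (meson DERIV_isCont atLeastAtMost_iff)
  qed
  then show False using max[OF inS[of T]] T by auto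
qed

text \<open>The barrier is \<open>exp (- \<alpha> |z - z0|\<^sup>2) - exp (- \<alpha> r\<^sup>2)\<close>: for large \<open>\<alpha>\<close> it is a strict
  subsolution on the annulus outside the ball of radius \<open>r / 2\<close>. The operator enters only
  through frames \<open>p\<close> in which it is a sum of pure second derivatives plus a drift \<open>b\<close>.\<close>

lemma hopf:
  fixes u :: "'a::euclidean_space \<Rightarrow> real"
  assumes r: "r > 0" and cont: "continuous_on (cball z0 r) u"
    and du: "\<And>z. z \<in> ball z0 r \<Longrightarrow> (u has_derivative u1 z) (at z)"
    and d2u: "\<And>z v. z \<in> ball z0 r \<Longrightarrow> ((\<lambda>x. u1 x v) has_derivative u2 z v) (at z)"
    and mu: "\<mu> > 0"
    and ell: "\<And>z. z \<in> ball z0 r \<Longrightarrow> \<exists>(p::'k::finite \<Rightarrow> 'a) b. (\<forall>k. norm (p k) \<le> C) \<and> norm b \<le> C \<and>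
        (\<forall>v. \<mu> * (norm v)\<^sup>2 \<le> (\<Sum>k\<in>UNIV. (v \<bullet> p k)\<^sup>2)) \<and> (\<Sum>k\<in>UNIV. u2 z (p k) (p k)) = u1 z b"
    and less: "\<And>z. z \<in> ball z0 r \<Longrightarrow> u z < m"
    and q: "u q = m" "dist z0 q = r" and dq: "(u has_derivative u') (at q within cball z0 r)"
  shows "0 < u' (q - z0)"
proof -
  define K where "K = real CARD('k)"
  have C0: "0 \<le> C" using ell[of z0] r by (metis centre_in_ball norm_ge_zero order_trans)
  have K1: "K \<ge> 1" by (simp add: K_def Suc_leI)
  \<comment> \<open>Chosen so that \<open>2 * \<alpha> * \<mu> * (r/2)\<^sup>2 = K * C\<^sup>2 + r *
    C + 1\<close>. For \<open>norm (s - z0) \<ge> r/2\<close> the square term then beats the trace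
    of the frame, at most \<open>K * C\<^sup>2\<close>, and the drift, at most \<open>r * C\<close>,
    with \<open>1\<close> to spare.\<close>
  define \<alpha> where "\<alpha> = 2 * (K * C\<^sup>2 + r * C + 1) / (\<mu> * r\<^sup>2)"
  have num: "K * C\<^sup>2 + r * C + 1 > 0" using C0 K1 r by (simp add: add_nonneg_pos)
  have al: "\<alpha> > 0" unfolding \<alpha>_def using mu r num by simp
  have al2: "\<alpha> * (\<mu> * r\<^sup>2) = 2 * (K * C\<^sup>2 + r * C + 1)" unfolding \<alpha>_def using mu r by simp
  define g where "g z = exp (- \<alpha> * ((z - z0) \<bullet> (z - z0)))" for z
  define w where "w z = g z - exp (- \<alpha> * r\<^sup>2)" for z
  define w1 where "w1 z v = - 2 * \<alpha> * ((z - z0) \<bullet> v) * g z" for z v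
  define w2 where "w2 z v h = - 2 * \<alpha> * (h \<bullet> v) * g z + 4 * \<alpha>\<^sup>2 * ((z - z0) \<bullet> v) * ((z - z0) \<bullet> h) * g z" for z v h
  have gpos: "g z > 0" for z by (simp add: g_def)
  have dg: "(g has_derivative w1 z) (at z within T)" for z T
    unfolding g_def[abs_def] w1_def
    by (rule derivative_eq_intros refl)+ (auto simp: algebra_simps inner_commute fun_eq_iff)
  have dw: "(w has_derivative w1 z) (at z within T)" for z T
    unfolding w_def[abs_def] using has_derivative_diff[OF dg has_derivative_const] by auto
  have d2w: "((\<lambda>x. w1 x v) has_derivative w2 z v) (at z within T)" for z v T
  proof -
    have "((\<lambda>x. (x - z0) \<bullet> v) has_derivative (\<lambda>h. h \<bullet> v)) (at z within T)"
      by (auto intro!: derivative_eq_intros)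
    from has_derivative_mult_right[OF has_derivative_mult[OF this dg], of "- 2 * \<alpha>"]
    show ?thesis
      unfolding w1_def[abs_def] w2_def[abs_def]
      by (simp add: algebra_simps power2_eq_square)
  qed
  have gle: "g z \<le> 1" for z using al by (simp add: g_def)
  have wle: "w z < 1" for z using gle[of z] exp_gt_zero[of "- \<alpha> * r\<^sup>2"] unfolding w_def by linarith
  have wsph: "w z = 0" if "dist z0 z = r" for z
  proof -
    have "(z - z0) \<bullet> (z - z0) = r\<^sup>2" using that
      by (simp add: dist_norm norm_minus_commute power2_norm_eq_inner[symmetric])
    then show ?thesis by (simp add: w_def g_def)
  qed
  have qc: "q \<in> cball z0 r" using q by simp
  have le: "u z \<le> m" if "z \<in> cball z0 r" for z
  proof -
    have "z \<in> closure (ball z0 r)" using that r by simp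
    moreover have "continuous_on (closure (ball z0 r)) u" using cont r by simp
    ultimately show ?thesis
      using continuous_le_on_closure[of "ball z0 r" u z m] less by (meson less_imp_le)
  qed
  obtain x0 where x0: "x0 \<in> cball z0 (r/2)" "\<And>x. x \<in> cball z0 (r/2) \<Longrightarrow> u x \<le> u x0"
  proof -
    have "cball z0 (r/2) \<subseteq> cball z0 r" using r by auto
    then have "continuous_on (cball z0 (r/2)) u" using cont continuous_on_subset by blast
    then show ?thesis using continuous_attains_sup[OF compact_cball, of z0 "r/2" u] r that by auto
  qed
  \<comment> \<open>The gap between \<open>m\<close> and the maximum of \<open>u\<close> on the
    inner ball. As \<open>w < 1\<close>, adding \<open>\<epsilon> * w\<close> cannot lift
    \<open>u\<close> above \<open>m\<close> there, and on the sphere \<open>w = 0\<close>; so a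
    maximum of \<open>U\<close> above \<open>m\<close> could only lie in the open annulus.\<close>
  define \<epsilon> where "\<epsilon> = m - u x0"
  have eps: "\<epsilon> > 0" using x0(1) less[of x0] r by (simp add: \<epsilon>_def)
  define U where "U z = u z + \<epsilon> * w z" for z
  define U1 where "U1 z v = u1 z v + \<epsilon> * w1 z v" for z v
  define U2 where "U2 z v h = u2 z v h + \<epsilon> * w2 z v h" for z v h
  have Ule: "U z \<le> m" if zc: "z \<in> cball z0 r" for z
  proof -
    have "continuous_on (cball z0 r) w" 
      by (rule has_derivative_continuous_on[OF dw])
    then have "continuous_on (cball z0 r) U"
      unfolding U_def[abs_def] by (intro continuous_intros cont)
    then obtain s where s: "s \<in> cball z0 r" "\<And>x. x \<in> cball z0 r \<Longrightarrow> U x \<le> U s"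
      using continuous_attains_sup[OF compact_cball, of z0 r U] r by auto
    have "U s \<le> m"
    proof (rule ccontr)
      assume nle: "\<not> U s \<le> m"
      have "dist z0 s \<noteq> r" using nle le[OF s(1)] wsph[of s] by (auto simp: U_def)
      then have sb: "s \<in> ball z0 r" using s by auto
      have "s \<notin> cball z0 (r/2)"
      proof
        assume "s \<in> cball z0 (r/2)"
        then have "u s \<le> m - \<epsilon>" using x0(2) by (simp add: \<epsilon>_def)
        moreover have "\<epsilon> * w s \<le> \<epsilon> * 1" using wle[of s] eps by (intro mult_left_mono) auto
        ultimately show False using nle by (simp add: U_def)
      qed
      then have ns: "norm (s - z0) > r/2" by (simp add: dist_norm norm_minus_commute)
      have ns': "norm (s - z0) \<le> r" using s by (simp add: dist_norm norm_minus_commute)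
      have dU: "(U has_derivative U1 x) (at x)" if "x \<in> ball z0 r" for x
        unfolding U_def[abs_def] U1_def[abs_def]
        by (intro has_derivative_add has_derivative_mult_right du that dw)
      have d2U: "((\<lambda>x. U1 x v) has_derivative U2 s v) (at s)" for v
        unfolding U1_def U2_def[abs_def]
        by (intro has_derivative_add has_derivative_mult_right d2u sb d2w)
      have smax: "U x \<le> U s" if "x \<in> ball z0 r" for x using s(2) that by auto
      have U1s: "U1 s = (\<lambda>v. 0)"
        using differential_zero_maxmin[OF sb open_ball dU[OF sb]] smax by blast
      have U2s: "U2 s v v \<le> 0" for v
        by (rule second_derivative_test[OF open_ball sb dU d2U smax])
      obtain p :: "'k \<Rightarrow> 'a" and b where pb: "\<And>k. norm (p k) \<le> C" "norm b \<le> C"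
        "\<And>v. \<mu> * (norm v)\<^sup>2 \<le> (\<Sum>k\<in>UNIV. (v \<bullet> p k)\<^sup>2)" "(\<Sum>k\<in>UNIV. u2 s (p k) (p k)) = u1 s b"
        using ell[OF sb] by blast
      \<comment> \<open>At an interior maximum the pure second derivatives of \<open>U\<close> are
        nonpositive and \<open>U1 s = 0\<close>, so the drift of \<open>u\<close> can be traded for
        that of \<open>\<epsilon> * w\<close>. The equation for \<open>u\<close> drops out and an
        inequality for the barrier alone remains.\<close>
      have "0 \<ge> (\<Sum>k\<in>UNIV. U2 s (p k) (p k))" by (intro sum_nonpos U2s)
      also have "(\<Sum>k\<in>UNIV. U2 s (p k) (p k)) = u1 s b + \<epsilon> * (\<Sum>k\<in>UNIV. w2 s (p k) (p k))"
        by (simp add: U2_def sum.distrib pb sum_distrib_left)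
      also have "u1 s b = - \<epsilon> * w1 s b" using fun_cong[OF U1s, of b] by (simp add: U1_def)
      finally have "\<epsilon> * ((\<Sum>k\<in>UNIV. w2 s (p k) (p k)) - w1 s b) \<le> 0" by (simp add: algebra_simps)
      then have "(\<Sum>k\<in>UNIV. w2 s (p k) (p k)) - w1 s b \<le> 0" using eps
        by (simp add: mult_le_0_iff)
      moreover have "(\<Sum>k\<in>UNIV. w2 s (p k) (p k)) - w1 s b = 2 * \<alpha> * g s *
        (2 * \<alpha> * (\<Sum>k\<in>UNIV. ((s - z0) \<bullet> p k)\<^sup>2) - (\<Sum>k\<in>UNIV. p k \<bullet> p k) + (s - z0) \<bullet> b)"
      proof -
        have "w2 s (p k) (p k) = 2 * \<alpha> * g s * (2 * \<alpha> * ((s - z0) \<bullet> p k)\<^sup>2 - p k \<bullet> p k)" for k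
          by (simp add: w2_def algebra_simps power2_eq_square)
        then have "(\<Sum>k\<in>UNIV. w2 s (p k) (p k)) = 2 * \<alpha> * g s *
            (2 * \<alpha> * (\<Sum>k\<in>UNIV. ((s - z0) \<bullet> p k)\<^sup>2) - (\<Sum>k\<in>UNIV. p k \<bullet> p k))"
          by (simp only: sum_distrib_left[symmetric] sum_subtractf)
        then show ?thesis by (simp only: w1_def) (simp only: algebra_simps minus_mult_left[symmetric] minus_mult_right[symmetric])
      qed
      moreover have "2 * \<alpha> * (\<Sum>k\<in>UNIV. ((s - z0) \<bullet> p k)\<^sup>2) - (\<Sum>k\<in>UNIV. p k \<bullet> p k) + (s - z0) \<bullet> b > 0"
      proof -
        have "(\<Sum>k\<in>UNIV. p k \<bullet> p k) \<le> (\<Sum>k\<in>(UNIV::'k set). C\<^sup>2)"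
          using pb(1) by (intro sum_mono) (simp add: power2_norm_eq_inner[symmetric] power_mono)
        then have 1: "(\<Sum>k\<in>UNIV. p k \<bullet> p k) \<le> K * C\<^sup>2" by (simp add: K_def)
        have "\<bar>(s - z0) \<bullet> b\<bar> \<le> norm (s - z0) * norm b" by (rule Cauchy_Schwarz_ineq2)
        also have "\<dots> \<le> r * C" using ns' pb(2) r by (intro mult_mono) auto
        finally have 2: "(s - z0) \<bullet> b \<ge> - (r * C)" by linarith
        have "(r/2)\<^sup>2 \<le> (norm (s - z0))\<^sup>2" using ns r by (intro power_mono) auto
        then have "2 * \<alpha> * (\<mu> * (r/2)\<^sup>2) \<le> 2 * \<alpha> * (\<mu> * (norm (s - z0))\<^sup>2)"
          using al mu by (intro mult_left_mono) auto
        also have "\<dots> \<le> 2 * \<alpha> * (\<Sum>k\<in>UNIV. ((s - z0) \<bullet> p k)\<^sup>2)"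
          using al pb(3) by (intro mult_left_mono) auto
        finally have "2 * \<alpha> * (\<mu> * (r/2)\<^sup>2) \<le> 2 * \<alpha> * (\<Sum>k\<in>UNIV. ((s - z0) \<bullet> p k)\<^sup>2)" .
        moreover have "2 * \<alpha> * (\<mu> * (r/2)\<^sup>2) = K * C\<^sup>2 + r * C + 1" using al2 by (simp add: power2_eq_square)
        ultimately show ?thesis using 1 2 by linarith
      qed
      ultimately show False using al gpos[of s] by (smt (verit) mult_pos_pos)
    qed
    then show ?thesis using s(2)[OF zc] by linarith
  qed
  have "((\<lambda>z. U z) has_derivative (\<lambda>v. u' v + \<epsilon> * w1 q v)) (at q within cball z0 r)"
    unfolding U_def[abs_def] by (intro has_derivative_add has_derivative_mult_right dq dw)
  moreover have Uq: "U q = m" using q wsph by (simp add: U_def)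
  ultimately have dUq: "(U has_derivative (\<lambda>v. u' v + \<epsilon> * w1 q v)) (at q within cball z0 r)" by simp
  \<comment> \<open>The inward radius from \<open>q\<close>. \<open>U \<circ> l\<close> has its
    maximum at \<open>0\<close>, so its one-sided slope \<open>c\<close> is not positive, and the
    strictly negative radial slope of the barrier forces \<open>u' (q - z0) > 0\<close>.\<close>
  define l where "l t = q - t *\<^sub>R (q - z0)" for t :: real
  have lin: "l ` {0..1} \<subseteq> cball z0 r"
  proof clarify
    fix t :: real assume t: "t \<in> {0..1}"
    have "l t - z0 = (1 - t) *\<^sub>R (q - z0)" by (simp add: l_def algebra_simps)
    then have "norm (l t - z0) = (1 - t) * r" using t q by (simp add: dist_norm norm_minus_commute)
    then have "dist z0 (l t) = (1 - t) * r" by (simp add: dist_norm norm_minus_commute)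
    then show "l t \<in> cball z0 r" using t r by (simp add: mult_left_le_one_le)
  qed
  have dl: "(l has_derivative (\<lambda>t. - t *\<^sub>R (q - z0))) (at 0 within {0..1})"
    unfolding l_def[abs_def] by (auto intro!: derivative_eq_intros)
  have "(U has_derivative (\<lambda>v. u' v + \<epsilon> * w1 q v)) (at (l 0) within l ` {0..1})"
    using has_derivative_subset[OF dUq lin] by (simp add: l_def)
  from diff_chain_within[OF dl this]
  have dUl: "(U \<circ> l has_derivative (\<lambda>t. u' (- t *\<^sub>R (q - z0)) + \<epsilon> * w1 q (- t *\<^sub>R (q - z0)))) (at 0 within {0..1})"
    by (simp add: o_def)
  have linu: "linear u'" using dq has_derivative_linear by blast
  define c where "c = - (u' (q - z0) + \<epsilon> * w1 q (q - z0))"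
  have "u' (- t *\<^sub>R (q - z0)) + \<epsilon> * w1 q (- t *\<^sub>R (q - z0)) = t * c" for t
  proof -
    have "u' (- t *\<^sub>R (q - z0)) = - t * u' (q - z0)"
      using linear_scale[OF linu, of "- t" "q - z0"] by simp
    moreover have "w1 q (- t *\<^sub>R (q - z0)) = - t * w1 q (q - z0)" by (simp add: w1_def)
    ultimately show ?thesis by (simp only: c_def) (simp add: algebra_simps)
  qed
  then have "((U \<circ> l) has_real_derivative c) (at 0 within {0..1})"
    using dUl by (simp add: has_field_derivative_def mult_commute_abs)
  then have "\<not> 0 < c"
  proof (intro notI)
    assume "((U \<circ> l) has_real_derivative c) (at 0 within {0..1})" "0 < c"
    from has_real_derivative_pos_inc_right[OF this] obtain d where
      d: "d > 0" "\<And>h. h > 0 \<Longrightarrow> 0 + h \<in> {0..1} \<Longrightarrow> h < d \<Longrightarrow> (U \<circ> l) 0 < (U \<circ> l) (0 + h)" by blast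
    define h where "h = min (d/2) 1"
    have "(U \<circ> l) 0 < (U \<circ> l) h" using d(2)[of h] d(1) by (auto simp: h_def)
    moreover have "U (l h) \<le> m" using d(1) by (intro Ule subsetD[OF lin] imageI) (auto simp: h_def)
    ultimately show False using Uq by (simp add: l_def)
  qed
  moreover have "w1 q (q - z0) < 0"
  proof -
    have "(q - z0) \<bullet> (q - z0) = r\<^sup>2" using q
      by (simp add: dist_norm norm_minus_commute power2_norm_eq_inner[symmetric])
    then show ?thesis using al r gpos[of q] by (simp add: w1_def)
  qed
  then have "\<epsilon> * w1 q (q - z0) < 0" using eps by (simp add: mult_pos_neg)
  ultimately show ?thesis by (simp add: c_def)
qed

section \<open>Minimality in coordinates\<close>

text \<open>The \<open>p k\<close> are preimages of an orthonormal basis of \<open>range L\<close>.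
  With them as columns of \<open>P\<close>, \<open>transpose P ** (g ** P) = mat 1\<close>, hence
  the inverse Gram matrix is \<open>P ** transpose P\<close>. This turns the coordinate formula for
  mean curvature into a sum of pure second derivatives.\<close>

lemma trace_matrix_inv_gram:
  fixes L :: "real ^ 'n \<Rightarrow> 'b::euclidean_space" 
  assumes L: "linear L" "inj L"
  obtains p :: "'n \<Rightarrow> real ^ 'n" where "\<And>i j. L (p i) \<bullet> L (p j) = (if i = j then 1 else 0)"
    and "\<And>H. trace (matrix_inv (\<chi> i j. L (axis i 1) \<bullet> L (axis j 1)) ** H) =
      (\<Sum>k\<in>UNIV. \<Sum>i\<in>UNIV. \<Sum>j\<in>UNIV. p k $ i * p k $ j * H $ i $ j)"
proof -
  define g :: "real ^ 'n ^ 'n" where "g = (\<chi> i j. L (axis i 1) \<bullet> L (axis j 1))"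
  have sub: "subspace (range L)" using L by (simp add: linear_subspace_image)
  have "dim (UNIV :: (real ^ 'n) set) = dim (range L)"
    using dim_image_eq[OF L(1), of UNIV] L(2) by simp
  then obtain T :: "real ^ 'n \<Rightarrow> 'b"
    where T: "linear T" "range T = range L" "\<And>x. norm (T x) = norm x"
    by (rule isometries_subspaces[OF subspace_UNIV sub]) auto
  define p where "p k = inv L (T (axis k 1))" for k
  have Lp: "L (p k) = T (axis k 1)" for k
  proof -
    have "T (axis k 1) \<in> range L" using T(2) by blast
    then show ?thesis unfolding p_def by (simp add: f_inv_into_f)
  qed
  have "T x \<bullet> T y = x \<bullet> y" for x y
  proof -
    have "norm (T (x + y)) = norm (x + y)" "norm (T x) = norm x" "norm (T y) = norm y" using T(3) by auto
    then show ?thesis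
      by (simp add: dot_norm linear_add[OF T(1), symmetric])
  qed
  then have ortho: "L (p i) \<bullet> L (p j) = (if i = j then 1 else 0)" for i j
    by (simp add: Lp inner_axis_axis)
  have Lsum: "L v = (\<Sum>i\<in>UNIV. v $ i *\<^sub>R L (axis i 1))" for v
  proof -
    have "L v = L (\<Sum>i\<in>UNIV. v $ i *\<^sub>R axis i 1)"
      by (simp add: basis_expansion[of v, unfolded scalar_mult_eq_scaleR])
    then show ?thesis by (simp add: linear_sum[OF L(1)] linear_scale[OF L(1)])
  qed
  have bil: "L v \<bullet> L w = (\<Sum>i\<in>UNIV. \<Sum>j\<in>UNIV. v $ i * w $ j * g $ i $ j)" for v w
    unfolding Lsum[of v] Lsum[of w]
    by (simp only: inner_sum_left) (simp add: g_def inner_sum_right sum_distrib_left mult.assoc mult.left_commute)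
  define P :: "real ^ 'n ^ 'n" where "P = (\<chi> i k. p k $ i)"
  have "transpose P ** (g ** P) = mat 1"
  proof -
    have "(transpose P ** (g ** P)) $ k $ l = L (p k) \<bullet> L (p l)" for k l
      by (simp add: bil matrix_matrix_mult_def P_def transpose_def sum_distrib_left sum_distrib_right algebra_simps)
    then show ?thesis by (simp add: vec_eq_iff mat_def ortho)
  qed
  then have "(g ** P) ** transpose P = mat 1" using matrix_left_right_inverse by blast
  then have gP: "g ** (P ** transpose P) = mat 1" by (simp add: matrix_mul_assoc)
  then have "(P ** transpose P) ** g = mat 1" using matrix_left_right_inverse by blast
  then have inv: "matrix_inv g = P ** transpose P"
    using gP unfolding matrix_inv_def
    by (intro some_equality) (auto, metis matrix_mul_assoc matrix_mul_rid)
  have "trace (matrix_inv g ** H) = (\<Sum>k\<in>UNIV. \<Sum>i\<in>UNIV. \<Sum>j\<in>UNIV. p k $ i * p k $ j * H $ i $ j)" for H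
  proof -
    have "trace (matrix_inv g ** H) = (\<Sum>i\<in>UNIV. \<Sum>j\<in>UNIV. \<Sum>k\<in>UNIV. p k $ i * p k $ j * H $ j $ i)"
      by (simp add: inv trace_def matrix_matrix_mult_def P_def transpose_def sum_distrib_right)
    also have "\<dots> = (\<Sum>j\<in>UNIV. \<Sum>i\<in>UNIV. \<Sum>k\<in>UNIV. p k $ i * p k $ j * H $ j $ i)"
      by (rule sum.swap)
    also have "\<dots> = (\<Sum>j\<in>UNIV. \<Sum>k\<in>UNIV. \<Sum>i\<in>UNIV. p k $ i * p k $ j * H $ j $ i)"
      by (intro sum.cong refl sum.swap)
    also have "\<dots> = (\<Sum>k\<in>UNIV. \<Sum>j\<in>UNIV. \<Sum>i\<in>UNIV. p k $ i * p k $ j * H $ j $ i)"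
      by (rule sum.swap)
    finally show ?thesis by (simp add: mult.commute)
  qed
  then show ?thesis using that ortho unfolding g_def by blast
qed

text \<open>A nonzero normal component of \<open>h\<close>, normalised, would be a unit normal not
  orthogonal to \<open>h\<close>. This converts vanishing mean curvature in every unit normal
  direction into tangency of the traced second derivative.\<close>

lemma in_subspace_if_orthogonal_to_normals:
  fixes V :: "'b::euclidean_space set"
  assumes V: "subspace V" and h: "\<And>N. norm N = 1 \<Longrightarrow> (\<And>v. v \<in> V \<Longrightarrow> N \<bullet> v = 0) \<Longrightarrow> h \<bullet> N = 0"
  shows "h \<in> V"
proof -
  obtain y z where yz: "y \<in> span V" "\<And>w. w \<in> span V \<Longrightarrow> orthogonal z w" "h = y + z"
    using orthogonal_subspace_decomp_exists[of V h] by blast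
  have spV: "span V = V" using V by (simp add: span_eq_iff)
  have "z = 0"
  proof (rule ccontr)
    assume z: "z \<noteq> 0"
    define N where "N = z /\<^sub>R norm z"
    have "norm N = 1" using z by (simp add: N_def)
    moreover have "N \<bullet> v = 0" if "v \<in> V" for v
      using yz(2)[of v] that spV by (simp add: N_def orthogonal_def)
    ultimately have "h \<bullet> N = 0" by (rule h)
    moreover have "z \<bullet> y = 0" using yz(1,2) by (simp add: orthogonal_def)
    ultimately show False using z yz(3) by (simp add: N_def inner_add_left inner_add_right inner_commute)
  qed
  then show ?thesis using yz spV by simp
qed

locale immersed_patch =
  fixes S :: "(real ^ 'n::finite) set" and X :: "real ^ 'n \<Rightarrow> 'b::euclidean_space"
  assumes smooth: "smooth_on S X"
    and immersed: "\<And>z. z \<in> S \<Longrightarrow> inj (frechet_derivative X (at z within S))"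
begin

abbreviation "DX z \<equiv> frechet_derivative X (at z within S)"

abbreviation "D2X z v \<equiv> frechet_derivative (\<lambda>x. DX x v) (at z within S)"

lemma Ck: "Ck_on k S X"
  using smooth by (simp add: smooth_on_def)

lemma has_derivative_X: "z \<in> S \<Longrightarrow> (X has_derivative DX z) (at z within S)"
  using Ck[of 1] by (simp add: differentiable_on_def frechet_derivative_works)

lemma linear_DX: "z \<in> S \<Longrightarrow> linear (DX z)"
  using has_derivative_X has_derivative_linear by blast

lemma has_derivative_DX: "z \<in> S \<Longrightarrow> ((\<lambda>x. DX x v) has_derivative D2X z v) (at z within S)"
  using Ck[of 2] by (simp add: numeral_2_eq_2 differentiable_on_def frechet_derivative_works)

lemma continuous_X: "continuous_on S X"
  using Ck[of 0] by simp

lemma continuous_DX: "continuous_on S (\<lambda>z. DX z v)"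
  using Ck[of 1] by simp

lemma continuous_D2X: "continuous_on S (\<lambda>z. D2X z v w)"
  using Ck[of 2] by (simp add: numeral_2_eq_2)

text \<open>\<open>Ck_on\<close> controls \<open>DX z v\<close> as a function of \<open>z\<close>
  for each fixed direction \<open>v\<close>. Expanding in the axes reduces joint statements in
  \<open>z\<close> and \<open>v\<close> to finitely many such functions.\<close>

lemma DX_expand: "z \<in> S \<Longrightarrow> DX z v = (\<Sum>i\<in>UNIV. v $ i *\<^sub>R DX z (axis i 1))"
proof -
  assume z: "z \<in> S"
  have "DX z v = DX z (\<Sum>i\<in>UNIV. v $ i *\<^sub>R axis i 1)"
    by (simp add: basis_expansion[of v, unfolded scalar_mult_eq_scaleR])
  then show ?thesis using linear_DX[OF z] by (simp add: linear_sum linear_scale)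
qed

text \<open>\<open>DX\<close> is jointly continuous on \<open>K\<close> times the unit sphere, which
  is compact, and injectivity keeps it away from zero there; the extrema of its norm are the two
  constants.\<close>

lemma DX_bounds:
  assumes K: "compact K" "K \<subseteq> S"
  obtains l L where "l > 0" "L > 0" "\<And>z v. z \<in> K \<Longrightarrow> l * norm v \<le> norm (DX z v)"
    "\<And>z v. z \<in> K \<Longrightarrow> norm (DX z v) \<le> L * norm v"
proof (cases "K = {}")
  case True
  then show ?thesis using that[of 1 1] by auto
next
  case ne: False
  define T where "T = K \<times> sphere (0 :: real ^ 'n) 1"
  define F where "F = (\<lambda>zv. norm (DX (fst zv) (snd zv)))"
  have T: "compact T" "T \<noteq> {}" using K ne by (auto simp: T_def compact_Times)
  have "continuous_on T (\<lambda>zv. norm (\<Sum>i\<in>UNIV. snd zv $ i *\<^sub>R DX (fst zv) (axis i 1)))"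
    by (intro continuous_intros continuous_on_compose2[OF continuous_DX])
      (use K in \<open>auto simp: T_def\<close>)
  moreover have "F zv = norm (\<Sum>i\<in>UNIV. snd zv $ i *\<^sub>R DX (fst zv) (axis i 1))" if "zv \<in> T" for zv
    using DX_expand[of "fst zv" "snd zv"] that K by (auto simp: T_def F_def)
  ultimately have cF: "continuous_on T F" by (simp cong: continuous_on_cong)
  obtain a where a: "a \<in> T" "\<And>x. x \<in> T \<Longrightarrow> F a \<le> F x"
    using continuous_attains_inf[OF T cF] by blast
  obtain b where b: "b \<in> T" "\<And>x. x \<in> T \<Longrightarrow> F x \<le> F b"
    using continuous_attains_sup[OF T cF] by blast
  have aS: "fst a \<in> S" "norm (snd a) = 1" using a(1) K by (auto simp: T_def)
  have "F a > 0"
  proof -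
    have "snd a \<noteq> 0" using aS by auto
    then have "DX (fst a) (snd a) \<noteq> 0"
      using immersed[OF aS(1)] linear_DX[OF aS(1)] by (metis injD linear_0)
    then show ?thesis by (simp add: F_def)
  qed
  moreover have "F a * norm v \<le> norm (DX z v) \<and> norm (DX z v) \<le> F b * norm v" if z: "z \<in> K" for z v
  proof (cases "v = 0")
    case True
    then show ?thesis using linear_DX z K by (simp add: linear_0 subset_iff)
  next
    case False
    then have "(z, v /\<^sub>R norm v) \<in> T" using z by (simp add: T_def)
    then have "F a \<le> F (z, v /\<^sub>R norm v)" "F (z, v /\<^sub>R norm v) \<le> F b" using a b by auto
    moreover have "norm (DX z v) = F (z, v /\<^sub>R norm v) * norm v"
      using linear_DX[of z] z K False by (auto simp: F_def linear_scale subset_iff)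
    ultimately show ?thesis by (simp add: mult_right_mono)
  qed
  moreover have "F a \<le> F b" using a b by auto
  ultimately show ?thesis using that[of "F a" "F b"] by (smt (verit))
qed

lemma D2X_bound:
  assumes K: "compact K" "K \<subseteq> S"
  obtains B where "B \<ge> 0" "\<And>z i j. z \<in> K \<Longrightarrow> norm (D2X z (axis j 1) (axis i 1)) \<le> B"
proof -
  have "\<exists>B. \<forall>z\<in>K. norm (D2X z (axis (snd ij) 1) (axis (fst ij) 1)) \<le> B" for ij :: "'n \<times> 'n"
  proof -
    have "bounded ((\<lambda>z. D2X z (axis (snd ij) 1) (axis (fst ij) 1)) ` K)"
      by (intro compact_imp_bounded compact_continuous_image K(1)
          continuous_on_subset[OF continuous_D2X K(2)])
    then show ?thesis by (simp add: bounded_iff)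
  qed
  then obtain B where B: "\<And>ij z. z \<in> K \<Longrightarrow> norm (D2X z (axis (snd ij) 1) (axis (fst ij) 1)) \<le> B ij"
    by metis
  have "norm (D2X z (axis j 1) (axis i 1)) \<le> (\<Sum>ij\<in>UNIV. \<bar>B ij\<bar>)" if "z \<in> K" for z i j
  proof -
    have "norm (D2X z (axis j 1) (axis i 1)) \<le> \<bar>B (i, j)\<bar>" using B[of z "(i, j)"] that by simp
    also have "\<dots> \<le> (\<Sum>ij\<in>UNIV. \<bar>B ij\<bar>)" by (rule member_le_sum) auto
    finally show ?thesis .
  qed
  then show ?thesis using that[of "\<Sum>ij\<in>UNIV. \<bar>B ij\<bar>"] by (auto intro: sum_nonneg)
qed

end

locale minimal_patch = immersed_patch S X
  for S :: "(real ^ 'n::finite) set" and X :: "real ^ 'n \<Rightarrow> 'b::euclidean_space" +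
  assumes minimal: "\<And>z N. z \<in> S \<Longrightarrow> norm N = 1 \<Longrightarrow> (\<And>v. N \<bullet> DX z v = 0) \<Longrightarrow> mean_curvature S X N z = 0"
begin

text \<open>The second derivative expanded in both arguments: bilinear by construction and built
  from exactly the vectors paired with \<open>N\<close> in \<open>second_fundamental_form\<close>.
  Linearity of \<open>D2X z v\<close> in \<open>v\<close> would depend on uniqueness of derivatives
  within \<open>S\<close>.\<close>

definition d2 :: "real ^ 'n \<Rightarrow> real ^ 'n \<Rightarrow> real ^ 'n \<Rightarrow> 'b"
  where "d2 z v w = (\<Sum>j\<in>UNIV. v $ j *\<^sub>R (\<Sum>i\<in>UNIV. w $ i *\<^sub>R D2X z (axis j 1) (axis i 1)))"

lemma has_derivative_d2:
  assumes z: "z \<in> S" shows "((\<lambda>x. DX x v) has_derivative d2 z v) (at z within S)"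
proof -
  have lin: "linear (D2X z w)" for w using has_derivative_DX[OF z] has_derivative_linear by blast
  have eq: "D2X z w h = (\<Sum>i\<in>UNIV. h $ i *\<^sub>R D2X z w (axis i 1))" for w h
  proof -
    have "D2X z w h = D2X z w (\<Sum>i\<in>UNIV. h $ i *\<^sub>R axis i 1)"
      by (simp add: basis_expansion[of h, unfolded scalar_mult_eq_scaleR])
    then show ?thesis using lin by (simp add: linear_sum linear_scale)
  qed
  have "d2 z v = (\<lambda>h. \<Sum>j\<in>UNIV. v $ j *\<^sub>R D2X z (axis j 1) h)"
    by (rule ext) (simp only: d2_def eq[symmetric])
  moreover have "((\<lambda>x. \<Sum>j\<in>UNIV. v $ j *\<^sub>R DX x (axis j 1)) has_derivative
      (\<lambda>h. \<Sum>j\<in>UNIV. v $ j *\<^sub>R D2X z (axis j 1) h)) (at z within S)"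
    by (intro has_derivative_sum has_derivative_scaleR_right has_derivative_DX z)
  ultimately have "((\<lambda>x. \<Sum>j\<in>UNIV. v $ j *\<^sub>R DX x (axis j 1)) has_derivative d2 z v) (at z within S)"
    by simp
  then show ?thesis by (rule has_derivative_transform[OF z, rotated]) (rule DX_expand)
qed

text \<open>In a frame that \<open>DX\<close> maps to an orthonormal one, minimality says that the trace of the
  second derivative is tangential; its tangential part is the drift \<open>b\<close>.\<close>

lemma elliptic:
  assumes K: "compact K" "K \<subseteq> S"
  obtains C \<mu> where "\<mu> > 0"
    "\<And>z. z \<in> K \<Longrightarrow> \<exists>(p::'n \<Rightarrow> real ^ 'n) b. (\<forall>k. norm (p k) \<le> C) \<and> norm b \<le> C \<and>
        (\<forall>v. \<mu> * (norm v)\<^sup>2 \<le> (\<Sum>k\<in>UNIV. (v \<bullet> p k)\<^sup>2)) \<and> (\<Sum>k\<in>UNIV. d2 z (p k) (p k)) = DX z b"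
proof -
  obtain l L where lL: "l > 0" "L > 0" "\<And>z v. z \<in> K \<Longrightarrow> l * norm v \<le> norm (DX z v)"
    "\<And>z v. z \<in> K \<Longrightarrow> norm (DX z v) \<le> L * norm v"
    by (rule DX_bounds[OF K]) blast
  obtain B where B: "B \<ge> 0" "\<And>z i j. z \<in> K \<Longrightarrow> norm (D2X z (axis j 1) (axis i 1)) \<le> B"
    by (rule D2X_bound[OF K]) blast
  \<comment> \<open>Components of the frame are at most \<open>1/l\<close> and second partials at
    most \<open>B\<close>; each factor \<open>CARD\<close> comes from one of three sums, and the
    last division by \<open>l\<close> passes from \<open>norm (DX z b)\<close> to
    \<open>norm b\<close>.\<close>
  define C1 where "C1 = real CARD('n) * (real CARD('n) * (1/l * (real CARD('n) * (1/l * B)))) / l"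
  define C where "C = max (1/l) C1"
  define \<mu> where "\<mu> = 1 / L\<^sup>2"
  have main: "\<exists>(p::'n \<Rightarrow> real ^ 'n) b. (\<forall>k. norm (p k) \<le> C) \<and> norm b \<le> C \<and>
        (\<forall>v. \<mu> * (norm v)\<^sup>2 \<le> (\<Sum>k\<in>UNIV. (v \<bullet> p k)\<^sup>2)) \<and> (\<Sum>k\<in>UNIV. d2 z (p k) (p k)) = DX z b"
    if z: "z \<in> K" for z
  proof -
    have zS: "z \<in> S" using z K by blast
    note lin = linear_DX[OF zS] and inj = immersed[OF zS]
    obtain p :: "'n \<Rightarrow> real ^ 'n" where
      orth: "\<And>i j. DX z (p i) \<bullet> DX z (p j) = (if i = j then 1 else 0)" and
      tr: "\<And>H. trace (matrix_inv (\<chi> i j. DX z (axis i 1) \<bullet> DX z (axis j 1)) ** H) =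
        (\<Sum>k\<in>UNIV. \<Sum>i\<in>UNIV. \<Sum>j\<in>UNIV. p k $ i * p k $ j * H $ i $ j)"
      by (rule trace_matrix_inv_gram[OF lin inj]) blast
    have nDp: "norm (DX z (p k)) = 1" for k using orth[of k k] by (simp add: norm_eq_sqrt_inner)
    have np: "norm (p k) \<le> 1/l" for k
      using lL(3)[OF z, of "p k"] lL(1) by (simp add: nDp field_simps)
    define h where "h = (\<Sum>k\<in>UNIV. d2 z (p k) (p k))"
    have "h \<in> range (DX z)"
    proof (rule in_subspace_if_orthogonal_to_normals)
      show "subspace (range (DX z))" using lin by (simp add: linear_subspace_image)
      fix N assume N: "norm N = 1" "\<And>v. v \<in> range (DX z) \<Longrightarrow> N \<bullet> v = 0"
      have "0 = mean_curvature S X N z" using minimal[OF zS N(1)] N(2) by auto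
      also have "\<dots> = (\<Sum>k\<in>UNIV. \<Sum>i\<in>UNIV. \<Sum>j\<in>UNIV. p k $ i * p k $ j * (D2X z (axis j 1) (axis i 1) \<bullet> N))"
        by (simp add: mean_curvature_def first_fundamental_form_def second_fundamental_form_def
            partial_within_def[abs_def] tr)
      also have "\<dots> = (\<Sum>k\<in>UNIV. \<Sum>j\<in>UNIV. \<Sum>i\<in>UNIV. p k $ i * p k $ j * (D2X z (axis j 1) (axis i 1) \<bullet> N))"
        by (intro sum.cong refl sum.swap)
      also have "\<dots> = h \<bullet> N"
        by (simp add: h_def d2_def inner_sum_left sum_distrib_left mult.assoc mult.left_commute)
      finally show "h \<bullet> N = 0" by simp
    qed
    then obtain b where b: "h = DX z b" by blast
    have "norm h \<le> real CARD('n) * (real CARD('n) * (1/l * (real CARD('n) * (1/l * B))))"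
    proof -
      have c: "\<bar>p k $ i\<bar> \<le> 1/l" for k i using component_le_norm_cart[of "p k" i] np[of k] by linarith
      have sc: "norm (p k $ i *\<^sub>R w) \<le> 1/l * y" if "norm w \<le> y" for k i y and w :: 'b
        unfolding norm_scaleR using c that lL(1) by (intro mult_mono) auto
      have "norm (\<Sum>i\<in>UNIV. p k $ i *\<^sub>R D2X z (axis j 1) (axis i 1)) \<le> (\<Sum>i\<in>(UNIV::'n set). 1/l * B)" for k j
        by (intro sum_norm_le sc B(2) z)
      then have 1: "norm (\<Sum>i\<in>UNIV. p k $ i *\<^sub>R D2X z (axis j 1) (axis i 1)) \<le> real CARD('n) * (1/l * B)" for k j
        by simp
      have "norm (d2 z (p k) (p k)) \<le> (\<Sum>i\<in>(UNIV::'n set). 1/l * (real CARD('n) * (1/l * B)))" for k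
        unfolding d2_def by (intro sum_norm_le sc 1)
      then have 2: "norm (d2 z (p k) (p k)) \<le> real CARD('n) * (1/l * (real CARD('n) * (1/l * B)))" for k
        by simp
      have "norm h \<le> (\<Sum>i\<in>(UNIV::'n set). real CARD('n) * (1/l * (real CARD('n) * (1/l * B))))"
        unfolding h_def by (rule sum_norm_le) (use 2 in auto)
      then show ?thesis by simp
    qed
    moreover have "l * norm b \<le> norm h" using lL(3)[OF z, of b] b by simp
    ultimately have "l * norm b \<le> real CARD('n) * (real CARD('n) * (1/l * (real CARD('n) * (1/l * B))))"
      by linarith
    then have nb: "norm b \<le> C1" unfolding C1_def using lL(1) by (simp add: pos_le_divide_eq mult_ac)
    \<comment> \<open>Expand \<open>v\<close> in the frame with coefficients \<open>e\<close>. Since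
      \<open>DX z\<close> makes the frame orthonormal, the sum of \<open>(e k)\<^sup>2\<close> is
      the squared norm of \<open>DX z v\<close>, at most
      \<open>L\<^sup>2 * (norm v)\<^sup>2\<close>. Cauchy-Schwarz, with
      \<open>(norm v)\<^sup>2\<close> written as the sum of \<open>e k * (v \<bullet> p k)\<close>,
      gives the constant \<open>1 / L\<^sup>2\<close>.\<close>
    have "\<mu> * (norm v)\<^sup>2 \<le> (\<Sum>k\<in>UNIV. (v \<bullet> p k)\<^sup>2)" for v
    proof -
      have injp: "inj (\<lambda>k. DX z (p k))"
      proof (rule injI)
        fix i j assume "DX z (p i) = DX z (p j)"
        then show "i = j" using orth[of i j] orth[of i i] by (auto split: if_splits)
      qed
      have "pairwise orthogonal (range (\<lambda>k. DX z (p k)))"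
        by (auto simp: pairwise_def orthogonal_def orth)
      moreover have "0 \<notin> range (\<lambda>k. DX z (p k))"
      proof
        assume "0 \<in> range (\<lambda>k. DX z (p k))"
        then obtain k where "DX z (p k) = 0" by auto
        then show False using nDp[of k] by simp
      qed
      ultimately have indep: "independent (range (\<lambda>k. DX z (p k)))"
        by (simp add: pairwise_orthogonal_independent)
      have "range (DX z) \<subseteq> span (range (\<lambda>k. DX z (p k)))"
      proof (rule card_ge_dim_independent[OF _ indep])
        show "dim (range (DX z)) \<le> card (range (\<lambda>k. DX z (p k)))"
          using dim_image_eq[OF lin, of UNIV] inj by (simp add: card_image[OF injp])
      qed auto
      then have "DX z v \<in> span (range (\<lambda>k. DX z (p k)))" by blast
      then obtain e where e: "DX z v = (\<Sum>k\<in>UNIV. e k *\<^sub>R DX z (p k))"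
      proof -
        assume a: "\<And>e. DX z v = (\<Sum>k\<in>UNIV. e k *\<^sub>R DX z (p k)) \<Longrightarrow> thesis"
        obtain f where "DX z v = (\<Sum>x\<in>range (\<lambda>k. DX z (p k)). f x *\<^sub>R x)"
          using \<open>DX z v \<in> _\<close> span_finite[of "range (\<lambda>k. DX z (p k))"] by auto
        then show thesis using a[of "\<lambda>k. f (DX z (p k))"] by (simp add: sum.reindex[OF injp])
      qed
      have ve: "v = (\<Sum>k\<in>UNIV. e k *\<^sub>R p k)"
        by (rule injD[OF inj]) (use lin in \<open>simp add: e linear_sum linear_scale\<close>)
      have "(norm (DX z v))\<^sup>2 = (\<Sum>k\<in>UNIV. (e k)\<^sup>2)"
        unfolding power2_norm_eq_inner e inner_sum_left inner_sum_right inner_scaleR_left inner_scaleR_right orth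
        by (simp add: power2_eq_square if_distrib cong: if_cong)
      moreover have "(norm (DX z v))\<^sup>2 \<le> (L * norm v)\<^sup>2"
        using lL(4)[OF z, of v] by (intro power_mono) auto
      ultimately have e2: "(\<Sum>k\<in>UNIV. (e k)\<^sup>2) \<le> L\<^sup>2 * (norm v)\<^sup>2" by (simp add: power_mult_distrib)
      have "(norm v)\<^sup>2 = (\<Sum>k\<in>UNIV. e k * (v \<bullet> p k))"
        by (subst power2_norm_eq_inner, subst (2) ve) (simp add: inner_sum_right)
      then have "((norm v)\<^sup>2)\<^sup>2 = (\<Sum>k\<in>UNIV. e k * (v \<bullet> p k))\<^sup>2" by simp
      also have "\<dots> \<le> (\<Sum>k\<in>UNIV. (e k)\<^sup>2) * (\<Sum>k\<in>UNIV. (v \<bullet> p k)\<^sup>2)"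
        by (rule Cauchy_Schwarz_ineq_sum)
      also have "\<dots> \<le> (L\<^sup>2 * (norm v)\<^sup>2) * (\<Sum>k\<in>UNIV. (v \<bullet> p k)\<^sup>2)"
        using e2 by (intro mult_right_mono sum_nonneg) auto
      finally have "(norm v)\<^sup>2 * (norm v)\<^sup>2 \<le> (norm v)\<^sup>2 * (L\<^sup>2 * (\<Sum>k\<in>UNIV. (v \<bullet> p k)\<^sup>2))"
        by (simp add: power2_eq_square mult_ac)
      then have "(norm v)\<^sup>2 \<le> L\<^sup>2 * (\<Sum>k\<in>UNIV. (v \<bullet> p k)\<^sup>2)"
        by (cases "v = 0") (auto intro: sum_nonneg mult_left_le_imp_le[where c = "(norm v)\<^sup>2"])
      then show ?thesis using lL(2) by (simp add: \<mu>_def field_simps)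
    qed
    then show ?thesis using np nb b unfolding C_def h_def by (intro exI[of _ p] exI[of _ b]) (auto simp: le_max_iff_disj)
  qed
  have "\<mu> > 0" using lL(2) by (simp add: \<mu>_def)
  then show ?thesis using that main by blast
qed

end

section \<open>Maximum principles in a chart\<close>

text \<open>A point of the half-space is pushed inward along the \<open>bd_coord\<close> axis by
  less than its distance to the sphere. Values at boundary points are thereby limits of values at
  interior ones.\<close>

lemma in_closure_half_ball:
  fixes z :: "real ^ 'n::finite"
  assumes "y \<in> half_space" "y \<in> ball z e"
  shows "y \<in> closure (ball z e \<inter> {u. 0 < u $ bd_coord})"
proof (subst closure_approachable, intro allI impI)
  fix d :: real assume d: "d > 0"
  define t where "t = min (d/2) ((e - dist z y) / 2)"
  define y' where "y' = y + t *\<^sub>R axis bd_coord 1"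
  have t: "t > 0" "t < d" "t < e - dist z y" using d assms by (auto simp: t_def min_def)
  have dy: "dist y' y = t" using t by (simp add: y'_def dist_norm)
  have "dist z y' \<le> dist z y + dist y' y" by (metis dist_commute dist_triangle)
  then have "y' \<in> ball z e" using dy t by simp
  moreover have "0 < y' $ bd_coord" using assms(1) t by (simp add: y'_def half_space_def add_nonneg_pos)
  ultimately show "\<exists>x\<in>ball z e \<inter> {u. 0 < u $ bd_coord}. dist x y < d" using dy t by auto
qed

lemma open_half: "open {u :: real ^ 'n::finite. 0 < u $ bd_coord}"
  by (intro open_Collect_less continuous_intros)

lemma convex_half: "convex {u :: real ^ 'n::finite. 0 < u $ bd_coord}"
  using convex_halfspace_gt[of 0 "axis bd_coord 1 :: real ^ 'n"] by (simp add: inner_axis')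

lemma convex_half_space: "convex (half_space :: (real ^ 'n::finite) set)"
  by (auto simp: convex_def half_space_def)

lemma closed_half_space: "closed (half_space :: (real ^ 'n::finite) set)"
  unfolding half_space_def by (intro closed_Collect_le continuous_intros)

context immersed_patch
begin

text \<open>\<open>X - DX z\<close> has derivative of norm at most \<open>l/2\<close> near
  \<open>z\<close>, so the mean value inequality on the convex set
  \<open>cball z e \<inter> half_space\<close> leaves half of the lower bound of
  \<open>DX z\<close>. This is quantitative local injectivity up to the boundary, with no extension
  of \<open>X\<close> across it.\<close>

lemma bilipschitz:
  assumes z: "z \<in> S" and S: "openin (top_of_set half_space) S"
  obtains e l where "e > 0" "l > 0" "cball z e \<inter> half_space \<subseteq> S"
    "\<And>x y. x \<in> cball z e \<inter> half_space \<Longrightarrow> y \<in> cball z e \<inter> half_space \<Longrightarrow>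
      l * norm (x - y) \<le> norm (X x - X y)"
proof -
  obtain l L where l: "l > 0" "\<And>v. l * norm v \<le> norm (DX z v)"
    by (rule DX_bounds[of "{z}"]) (use z in auto)
  \<comment> \<open>The sum over the axes bounds the operator norm of \<open>DX x - DX z\<close> and
    is continuous because \<open>DX x v\<close> is for each fixed direction.\<close>
  define g where "g x = (\<Sum>i\<in>UNIV. norm (DX x (axis i 1) - DX z (axis i 1)))" for x
  have "continuous_on S g" unfolding g_def[abs_def] by (intro continuous_intros continuous_DX)
  moreover have "g z = 0" by (simp add: g_def)
  ultimately obtain d where d: "d > 0" "\<And>x. x \<in> S \<Longrightarrow> dist x z < d \<Longrightarrow> \<bar>g x\<bar> < l/2"
    using z l(1) unfolding continuous_on_iff dist_real_def
    by (metis (no_types, lifting) diff_zero half_gt_zero)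
  obtain e0 where e0: "e0 > 0" "ball z e0 \<inter> half_space \<subseteq> S"
    using S z by (meson openin_contains_ball)
  define e where "e = min (d/2) (e0/2)"
  define Q where "Q = cball z e \<inter> half_space"
  have e: "e > 0" "e < d" "e < e0" using d e0 by (auto simp: e_def)
  have QS: "Q \<subseteq> S" using e e0 by (auto simp: Q_def)
  have linz: "linear (DX z)" by (rule linear_DX[OF z])
  have bnd: "norm ((X x - DX z x) - (X y - DX z y)) \<le> l/2 * norm (x - y)" if "x \<in> Q" "y \<in> Q" for x y
  proof (rule differentiable_bound[where f = "\<lambda>x. X x - DX z x" and f' = "\<lambda>x v. DX x v - DX z v"])
    show "convex Q" unfolding Q_def by (intro convex_Int convex_cball convex_half_space)
    fix w assume w: "w \<in> Q"
    show "((\<lambda>x. X x - DX z x) has_derivative (\<lambda>v. DX w v - DX z v)) (at w within Q)"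
      using QS w linz
      by (intro has_derivative_diff has_derivative_subset[OF has_derivative_X]
          bounded_linear_imp_has_derivative) (auto simp: linear_linear)
    show "onorm (\<lambda>v. DX w v - DX z v) \<le> l/2"
    proof (rule onorm_le)
      fix v
      have "norm (DX w v - DX z v) = norm (\<Sum>i\<in>UNIV. v $ i *\<^sub>R (DX w (axis i 1) - DX z (axis i 1)))"
        using DX_expand[of w v] DX_expand[OF z, of v] w QS
        by (simp add: sum_subtractf[symmetric] scaleR_diff_right subset_iff)
      also have "\<dots> \<le> (\<Sum>i\<in>UNIV. norm v * norm (DX w (axis i 1) - DX z (axis i 1)))"
        by (intro sum_norm_le) (auto intro!: mult_right_mono component_le_norm_cart)
      also have "\<dots> = norm v * g w" by (simp add: g_def sum_distrib_left)
      also have "\<dots> \<le> norm v * (l/2)"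
        using d(2)[of w] w QS e by (intro mult_left_mono) (auto simp: Q_def dist_commute subset_iff)
      finally show "norm (DX w v - DX z v) \<le> l/2 * norm v" by (simp add: mult.commute)
    qed
  qed (use that in auto)
  have "l/2 * norm (x - y) \<le> norm (X x - X y)" if "x \<in> Q" "y \<in> Q" for x y
  proof -
    have "X x - X y = DX z (x - y) + ((X x - DX z x) - (X y - DX z y))"
      using linz by (simp add: linear_diff)
    then have "norm (DX z (x - y)) - norm ((X x - DX z x) - (X y - DX z y)) \<le> norm (X x - X y)"
      by (metis norm_diff_ineq)
    then show ?thesis using bnd[OF that] l(2)[of "x - y"] by (simp add: field_simps)
  qed
  then show ?thesis using that[of e "l/2"] e l QS unfolding Q_def by simp
qed

end

context minimal_patch
begin

text \<open>Pairing with the constant vector \<open>a\<close> carries \<open>elliptic\<close> over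
  to \<open>X z \<bullet> a\<close>. Derivatives in the open ball are two-sided because the ball
  lies in \<open>S\<close>, while \<open>q\<close> may be a boundary point of the half-space; both
  maximum principles use this form.\<close>

lemma hopf_patch:
  assumes r: "r > 0" and sub: "cball z0 r \<subseteq> S"
    and less: "\<And>z. z \<in> ball z0 r \<Longrightarrow> X z \<bullet> a < m"
    and q: "X q \<bullet> a = m" "dist z0 q = r"
  shows "0 < DX q (q - z0) \<bullet> a"
proof -
  obtain C \<mu> where mu: "\<mu> > 0" and ell: "\<And>z. z \<in> cball z0 r \<Longrightarrow> \<exists>(p::'n \<Rightarrow> real ^ 'n) b. (\<forall>k. norm (p k) \<le> C) \<and> norm b \<le> C \<and>
        (\<forall>v. \<mu> * (norm v)\<^sup>2 \<le> (\<Sum>k\<in>UNIV. (v \<bullet> p k)\<^sup>2)) \<and> (\<Sum>k\<in>UNIV. d2 z (p k) (p k)) = DX z b"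
    by (rule elliptic[OF compact_cball sub]) blast
  have at: "at z within S = at z" if "z \<in> ball z0 r" for z
    using at_within_open_subset[OF that open_ball] sub ball_subset_cball by blast
  have inS: "z \<in> S" if "z \<in> ball z0 r" for z using that sub ball_subset_cball by blast
  show ?thesis
  proof (rule hopf[where u = "\<lambda>z. X z \<bullet> a" and ?u1.0 = "\<lambda>z v. DX z v \<bullet> a" and ?u2.0 = "\<lambda>z v w. d2 z v w \<bullet> a"
        and u' = "\<lambda>v. DX q v \<bullet> a" and C = C, OF r _ _ _ mu _ less q])
    show "continuous_on (cball z0 r) (\<lambda>z. X z \<bullet> a)"
      using continuous_on_subset[OF continuous_X sub] by (intro continuous_intros)
    show "((\<lambda>z. X z \<bullet> a) has_derivative (\<lambda>v. DX z v \<bullet> a)) (at z)" if "z \<in> ball z0 r" for z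
      using has_derivative_X[OF inS[OF that]] at[OF that] by (intro has_derivative_inner_left) auto
    show "((\<lambda>x. DX x v \<bullet> a) has_derivative (\<lambda>w. d2 z v w \<bullet> a)) (at z)" if "z \<in> ball z0 r" for z v
      using has_derivative_d2[OF inS[OF that], of v] at[OF that] by (intro has_derivative_inner_left) auto
    show "\<exists>(p::'n \<Rightarrow> real ^ 'n) b. (\<forall>k. norm (p k) \<le> C) \<and> norm b \<le> C \<and>
        (\<forall>v. \<mu> * (norm v)\<^sup>2 \<le> (\<Sum>k\<in>UNIV. (v \<bullet> p k)\<^sup>2)) \<and> (\<Sum>k\<in>UNIV. d2 z (p k) (p k) \<bullet> a) = DX z b \<bullet> a"
      if "z \<in> ball z0 r" for z
    proof -
      have "z \<in> cball z0 r" using that by simp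
      from ell[OF this] obtain p :: "'n \<Rightarrow> real ^ 'n" and b where
        pb: "\<forall>k. norm (p k) \<le> C" "norm b \<le> C"
        "\<forall>v. \<mu> * (norm v)\<^sup>2 \<le> (\<Sum>k\<in>UNIV. (v \<bullet> p k)\<^sup>2)" "(\<Sum>k\<in>UNIV. d2 z (p k) (p k)) = DX z b"
        by blast
      show ?thesis
        by (intro exI[of _ p] exI[of _ b] conjI pb) (simp add: pb(4)[symmetric] inner_sum_left)
    qed
    show "((\<lambda>z. X z \<bullet> a) has_derivative (\<lambda>v. DX q v \<bullet> a)) (at q within cball z0 r)"
      using has_derivative_subset[OF has_derivative_X sub] sub q
      by (intro has_derivative_inner_left) auto
  qed
qed

lemma strong_maximum_principle:
  assumes G: "open G" "connected G" "G \<subseteq> S"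
    and le: "\<And>z. z \<in> G \<Longrightarrow> X z \<bullet> a \<le> m" and z1: "z1 \<in> G" "X z1 \<bullet> a = m"
    and z: "z \<in> G"
  shows "X z \<bullet> a = m"
proof -
  define K where "K = {z \<in> G. X z \<bullet> a = m}"
  have cont: "continuous_on G (\<lambda>z. X z \<bullet> a)"
    using continuous_on_subset[OF continuous_X G(3)] by (intro continuous_intros)
  have "closedin (top_of_set G) K"
    unfolding K_def using continuous_closedin_preimage_constant[OF cont] by simp
  moreover have "open K"
  proof (subst open_contains_ball, intro ballI)
    fix p assume p: "p \<in> K"
    then obtain e where e: "e > 0" "cball p e \<subseteq> G"
      using G(1) by (auto simp: K_def open_contains_cball)
    \<comment> \<open>With \<open>z0\<close> within \<open>e/3\<close> of \<open>p\<close>, the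
      nearest point \<open>q\<close> of the maximum set is closer to \<open>z0\<close> than
      \<open>e/3\<close>, so the touching ball stays in \<open>cball p e\<close>. The Hopf lemma
      then gives a nonzero derivative at \<open>q\<close>, an interior maximum.\<close>
    have "z0 \<in> K" if z0: "z0 \<in> ball p (e/3)" for z0
    proof (rule ccontr)
      assume nK: "z0 \<notin> K"
      define Kc where "Kc = {z \<in> cball p e. X z \<bullet> a = m}"
      have "closed Kc"
        unfolding Kc_def
        by (intro continuous_closed_preimage_constant continuous_on_subset[OF cont] e closed_cball)
      moreover have pKc: "p \<in> Kc" using p e by (auto simp: Kc_def K_def)
      ultimately obtain q where q: "q \<in> Kc" "\<And>y. y \<in> Kc \<Longrightarrow> dist z0 q \<le> dist z0 y"
        using distance_attains_inf[of Kc z0] by blast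
      define r where "r = dist z0 q"
      have qG: "q \<in> G" using q e by (auto simp: Kc_def)
      have rp: "r > 0" using nK q qG by (auto simp: r_def Kc_def K_def)
      have r3: "r < e/3" using q(2)[OF pKc] z0 by (simp add: r_def dist_commute)
      have sub: "cball z0 r \<subseteq> cball p e"
      proof
        fix y assume "y \<in> cball z0 r"
        moreover have "dist p y \<le> dist p z0 + dist z0 y" by (rule dist_triangle)
        ultimately show "y \<in> cball p e" using r3 z0 e(1) by auto
      qed
      have "0 < DX q (q - z0) \<bullet> a"
      proof (rule hopf_patch[OF rp])
        show "cball z0 r \<subseteq> S" using sub e G(3) by blast
        show "X q \<bullet> a = m" using q by (simp add: Kc_def)
        show "dist z0 q = r" by (simp add: r_def)
        fix y assume y: "y \<in> ball z0 r"
        then have "y \<notin> Kc" using q(2)[of y] by (auto simp: r_def)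
        moreover have "y \<in> cball p e" using y sub ball_subset_cball by blast
        ultimately show "X y \<bullet> a < m" using le[of y] e(2) by (auto simp: Kc_def less_le)
      qed
      moreover have "(\<lambda>v. DX q v \<bullet> a) = (\<lambda>v. 0)"
      proof (rule differential_zero_maxmin[OF qG G(1)])
        show "((\<lambda>z. X z \<bullet> a) has_derivative (\<lambda>v. DX q v \<bullet> a)) (at q)"
          using has_derivative_X[of q] at_within_open_subset[OF qG G(1) G(3)] qG G(3)
          by (intro has_derivative_inner_left) auto
        show "(\<forall>y\<in>G. X y \<bullet> a \<le> X q \<bullet> a) \<or> (\<forall>y\<in>G. X q \<bullet> a \<le> X y \<bullet> a)"
          using le q by (auto simp: Kc_def)
      qed
      ultimately show False by (metis less_irrefl)
    qed
    then show "\<exists>e>0. ball p e \<subseteq> K" using e by (intro exI[of _ "e/3"]) auto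
  qed
  then have "openin (top_of_set G) K" using G(1) by (auto simp: openin_open_eq K_def)
  ultimately have "K = {} \<or> K = G" using G(2) by (auto simp: connected_clopen)
  then show ?thesis using z1 z by (auto simp: K_def)
qed

text \<open>A direction with vanishing \<open>bd_coord\<close> component keeps the line through
  \<open>z\<close> in the half-space on both sides of \<open>z\<close>, so the two-sided
  one-variable criterion applies even at a boundary point.\<close>

lemma tangential_derivative_zero:
  assumes S: "openin (top_of_set half_space) S" and z: "z \<in> S" "z $ bd_coord = 0"
    and le: "\<And>y. y \<in> S \<Longrightarrow> X y \<bullet> a \<le> X z \<bullet> a" and w: "w $ bd_coord = 0"
  shows "DX z w \<bullet> a = 0"
proof -
  obtain e where e: "e > 0" "ball z e \<inter> half_space \<subseteq> S"
    using S z by (meson openin_contains_ball)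
  define d where "d = e / (norm w + 1)"
  have d: "d > 0" using e by (simp add: d_def add_nonneg_pos)
  define l where "l t = z + t *\<^sub>R w" for t :: real
  have lS: "l t \<in> S" if "\<bar>t\<bar> < d" for t
  proof -
    have "\<bar>t\<bar> * norm w \<le> \<bar>t\<bar> * (norm w + 1)" by (intro mult_left_mono) auto
    also have "\<dots> < d * (norm w + 1)" using that by (intro mult_strict_right_mono) (auto simp: add_nonneg_pos)
    also have "\<dots> = e" using norm_ge_zero[of w] by (simp add: d_def del: norm_ge_zero)
    finally have "l t \<in> ball z e" by (simp add: l_def dist_norm)
    moreover have "l t \<in> half_space" using z w by (simp add: l_def half_space_def)
    ultimately show ?thesis using e by blast
  qed
  have dl: "(l has_derivative (\<lambda>t. t *\<^sub>R w)) (at 0 within ball 0 d)"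
    unfolding l_def[abs_def] by (auto intro!: derivative_eq_intros)
  have "((\<lambda>y. X y \<bullet> a) has_derivative (\<lambda>v. DX z v \<bullet> a)) (at (l 0) within l ` ball 0 d)"
  proof (rule has_derivative_inner_left, rule has_derivative_subset)
    show "(X has_derivative DX z) (at (l 0) within S)"
      using has_derivative_X[OF z(1)] by (simp add: l_def)
    show "l ` ball 0 d \<subseteq> S" using lS by auto
  qed
  from diff_chain_within[OF dl this]
  have "((\<lambda>t. X (l t) \<bullet> a) has_derivative (\<lambda>t. DX z (t *\<^sub>R w) \<bullet> a)) (at 0 within ball 0 d)"
    by (simp add: o_def)
  then have "((\<lambda>t. X (l t) \<bullet> a) has_derivative (\<lambda>t. DX z (t *\<^sub>R w) \<bullet> a)) (at 0)"
    using d at_within_open[of "0::real" "ball 0 d"] by (metis centre_in_ball open_ball)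
  moreover have "(\<lambda>t. DX z (t *\<^sub>R w) \<bullet> a) = (*) (DX z w \<bullet> a)"
    by (rule ext) (simp add: linear_scale[OF linear_DX[OF z(1)]])
  ultimately have "DERIV (\<lambda>t. X (l t) \<bullet> a) 0 :> DX z w \<bullet> a"
    by (simp add: has_field_derivative_def)
  then show ?thesis
    by (rule DERIV_local_max[OF _ d]) (use le lS in \<open>auto simp: l_def\<close>)
qed

text \<open>Either the maximum is attained in the open part of a half-ball at \<open>z\<close> and
  spreads over it by the interior principle and continuity, or a ball inside touches the boundary at
  \<open>z\<close>. In the second case the Hopf lemma makes the derivative along every outward
  vector positive, against the sign assumed for \<open>v\<close>.\<close>

lemma boundary_maximum_principle:
  assumes S: "openin (top_of_set half_space) S" and z: "z \<in> S" "z $ bd_coord = 0"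
    and le: "\<And>y. y \<in> S \<Longrightarrow> X y \<bullet> a \<le> m" and m: "X z \<bullet> a = m"
    and v: "v $ bd_coord < 0" "DX z v \<bullet> a \<le> 0"
  shows "\<exists>e>0. \<forall>y\<in>S \<inter> ball z e. X y \<bullet> a = m"
proof -
  obtain e0 where e0: "e0 > 0" "ball z e0 \<inter> half_space \<subseteq> S"
    using S z by (meson openin_contains_ball)
  define e where "e = e0/2"
  have e: "e > 0" "cball z e \<inter> half_space \<subseteq> S" using e0 by (auto simp: e_def)
  define G where "G = ball z e \<inter> {u. 0 < u $ bd_coord}"
  have G: "open G" "connected G" "G \<subseteq> S"
    using e(2) by (auto simp: G_def half_space_def intro!: open_half convex_connected convex_Int convex_half)
  show ?thesis
  proof (cases "\<exists>z1\<in>G. X z1 \<bullet> a = m")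
    case True
    then obtain z1 where "z1 \<in> G" "X z1 \<bullet> a = m" by blast
    then have c: "X y \<bullet> a = m" if "y \<in> G" for y
      using strong_maximum_principle[OF G, of a m z1 y] le G(3) that by blast
    have "closure G \<subseteq> cball z e \<inter> half_space"
      by (rule closure_minimal) (auto simp: G_def half_space_def intro!: closed_half_space[unfolded half_space_def])
    then have "closure G \<subseteq> S" using e by blast
    then have cc: "continuous_on (closure G) (\<lambda>z. X z \<bullet> a)"
      using continuous_on_subset[OF continuous_X] by (intro continuous_intros) auto
    have "X y \<bullet> a = m" if "y \<in> S \<inter> ball z e" for y
    proof (rule continuous_constant_on_closure[OF cc c])
      show "y \<in> closure G" unfolding G_def
        using in_closure_half_ball[of y z e] that S openin_imp_subset by blast
    qed
    then show ?thesis using e by blast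
  next
    case False
    define \<nu> :: "real ^ 'n" where "\<nu> = axis bd_coord 1"
    \<comment> \<open>The ball of radius \<open>e/2\<close> about \<open>z0\<close> is tangent to
      the boundary hyperplane at \<open>z\<close> and lies in the open half-ball.\<close>
    define z0 where "z0 = z + (e/2) *\<^sub>R \<nu>"
    have nn: "norm \<nu> = 1" "\<nu> $ bd_coord = 1" by (simp_all add: \<nu>_def)
    have sub: "ball z0 (e/2) \<subseteq> G"
    proof
      fix y assume y: "y \<in> ball z0 (e/2)"
      have "\<bar>(y - z0) $ bd_coord\<bar> \<le> norm (y - z0)" by (rule component_le_norm_cart)
      then have "0 < y $ bd_coord" using y z nn by (simp add: z0_def dist_norm norm_minus_commute)
      moreover have "dist z y \<le> dist z z0 + dist z0 y" by (rule dist_triangle)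
      then have "dist z y < e" using y nn e by (simp add: z0_def dist_norm)
      ultimately show "y \<in> G" by (simp add: G_def)
    qed
    have "0 < DX z (z - z0) \<bullet> a"
    proof (rule hopf_patch)
      show "0 < e/2" using e by simp
      have "closure (ball z0 (e/2)) \<subseteq> cball z e \<inter> half_space"
        using sub by (intro closure_minimal closed_Int closed_half_space closed_cball)
          (auto simp: G_def half_space_def)
      then show "cball z0 (e/2) \<subseteq> S" using e by auto
      show "X z \<bullet> a = m" by fact
      show "dist z0 z = e/2" using nn e by (simp add: z0_def dist_norm)
      show "X y \<bullet> a < m" if "y \<in> ball z0 (e/2)" for y
        using that sub False le G(3) by (metis less_le subsetD)
    qed
    moreover note lin = linear_DX[OF z(1)]
    have "DX z (z - z0) = (- e/2) *\<^sub>R DX z \<nu>"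
      using linear_scale[OF lin, of "- e/2" \<nu>] by (simp add: z0_def)
    ultimately have neg: "DX z \<nu> \<bullet> a < 0" using e by (simp add: zero_less_mult_iff mult_less_0_iff)
    \<comment> \<open>The outward vector \<open>v\<close> may be oblique. Removing its
      \<open>\<nu>\<close> component leaves a direction tangent to the boundary, so the derivatives
      along \<open>v\<close> and \<open>\<nu>\<close> differ by the factor
      \<open>v $ bd_coord < 0\<close>.\<close>
    have "DX z (v - v $ bd_coord *\<^sub>R \<nu>) \<bullet> a = 0"
      using le nn m by (intro tangential_derivative_zero S z) auto
    then have "DX z v \<bullet> a = v $ bd_coord * (DX z \<nu> \<bullet> a)"
      using lin by (simp add: linear_diff linear_scale inner_diff_left)
    then show ?thesis using v neg by (smt (verit) mult_neg_neg)
  qed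
qed

end

section \<open>The normal of the rotational domain\<close>

text \<open>\<open>gradient_within\<close> is a definite description, so uniqueness has to be
  supplied. It suffices that each coordinate direction reaches points of \<open>S\<close>
  arbitrarily close to \<open>z\<close>, from either side, which covers end points of an
  interval.\<close>

lemma gradient_within_eqI:
  fixes F :: "'a::euclidean_space \<Rightarrow> real"
  assumes D: "(F has_derivative (\<lambda>h. D \<bullet> h)) (at z within S)"
    and dirs: "\<And>i e. i \<in> Basis \<Longrightarrow> e > 0 \<Longrightarrow> \<exists>d. 0 < \<bar>d\<bar> \<and> \<bar>d\<bar> < e \<and> z + d *\<^sub>R i \<in> S"
  shows "gradient_within F S z = D"
  unfolding gradient_within_def
proof (rule the_equality[where P = "\<lambda>D. (F has_derivative (\<lambda>h. D \<bullet> h)) (at z within S)", OF D])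
  fix D' assume "(F has_derivative (\<lambda>h. D' \<bullet> h)) (at z within S)"
  then have "(\<lambda>h. D' \<bullet> h) = (\<lambda>h. D \<bullet> h)"
    using D dirs by (rule frechet_derivative_unique_within)
  then show "D' = D" by (metis vector_eq_rdot)
qed

lemma nearby_point_in_interval:
  fixes I :: "real set"
  assumes I: "is_interval I" "interior I \<noteq> {}" and t: "t \<in> I" and e: "e > 0"
  obtains d where "0 < \<bar>d\<bar>" "\<bar>d\<bar> < e" "t + d \<in> I"
proof -
  have "interior I \<noteq> {t}" by (metis not_open_singleton open_interior)
  then obtain s where s: "s \<in> I" "s \<noteq> t" using I(2) interior_subset by blast
  define r where "r = min 1 (e / (2 * \<bar>s - t\<bar>))"
  have r: "0 < r" "r \<le> 1" using s e by (auto simp: r_def)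
  have "\<bar>r * (s - t)\<bar> = r * \<bar>s - t\<bar>" using r by (simp add: abs_mult)
  also have "\<dots> \<le> e / (2 * \<bar>s - t\<bar>) * \<bar>s - t\<bar>" by (intro mult_right_mono) (auto simp: r_def)
  also have "\<dots> < e" using s e by simp
  finally have "\<bar>r * (s - t)\<bar> < e" .
  moreover have "t + r * (s - t) \<in> I"
  proof -
    have "(1 - r) *\<^sub>R t + r *\<^sub>R s \<in> I"
      using I(1) t s r by (intro convexD_alt) (auto simp: is_interval_convex)
    then show ?thesis by (simp add: algebra_simps)
  qed
  moreover have "0 < \<bar>r * (s - t)\<bar>" using r s by simp
  ultimately show ?thesis using that by blast
qed

lemma gradient_defining_function:
  fixes x :: "real ^ 'n::finite"
  assumes I: "is_interval I" "interior I \<noteq> {}" and f: "smooth_on I f" and t: "t \<in> I"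
  shows "gradient_within (defining_function f) (UNIV \<times> I) (x, t) =
    (2 *\<^sub>R x, - 2 * f t * vector_derivative f (at t within I))"
proof (rule gradient_within_eqI)
  define f' where "f' = vector_derivative f (at t within I)"
  have "Ck_on 1 I f" using f unfolding smooth_on_def by blast
  then have "f differentiable (at t within I)" using t by (simp add: differentiable_on_def)
  then have "(f has_vector_derivative f') (at t within I)" unfolding f'_def by (simp add: vector_derivative_works)
  then have df: "(f has_derivative (\<lambda>h. h * f')) (at t within I)" by (simp add: has_vector_derivative_def)
  have "(f has_derivative (\<lambda>h. h * f')) (at (snd (x, t)) within snd ` ((UNIV :: (real ^ 'n) set) \<times> I))"
    using df by simp
  then have "((\<lambda>z. f (snd z)) has_derivative (\<lambda>h. snd h * f')) (at (x, t) within UNIV \<times> I)"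
    by (rule has_derivative_in_compose[OF has_derivative_snd[OF has_derivative_ident]])
  then have "((\<lambda>z. fst z \<bullet> fst z - f (snd z) * f (snd z) + 1) has_derivative
      (\<lambda>h. (2 *\<^sub>R x, - 2 * f t * f') \<bullet> h)) (at (x, t) within UNIV \<times> I)"
    by (auto intro!: derivative_eq_intros simp: inner_prod_def inner_commute algebra_simps fun_eq_iff)
  then show "(defining_function f has_derivative
      (\<lambda>h. (2 *\<^sub>R x, - 2 * f t * vector_derivative f (at t within I)) \<bullet> h)) (at (x, t) within UNIV \<times> I)"
    by (simp add: defining_function_def[abs_def] case_prod_unfold power2_norm_eq_inner
        power2_eq_square[of "f _"] f'_def)
next
  fix i :: "(real ^ 'n) \<times> real" and e :: real
  assume i: "i \<in> Basis" and e: "e > 0"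
  obtain d where d: "0 < \<bar>d\<bar>" "\<bar>d\<bar> < e" "t + d \<in> I"
    by (rule nearby_point_in_interval[OF I t e])
  show "\<exists>d. 0 < \<bar>d\<bar> \<and> \<bar>d\<bar> < e \<and> (x, t) + d *\<^sub>R i \<in> UNIV \<times> I"
    using d i t by (auto simp: Basis_prod_def intro!: exI[of _ d])
qed

section \<open>Linear functions on a minimal hypersurface with boundary\<close>

locale immersed_manifold =
  fixes M :: "'m topology" and A :: "('m, 'n::finite) chart set" and \<phi> :: "'m \<Rightarrow> 'b::euclidean_space"
  assumes manifold: "smooth_manifold_with_boundary M A" and immersion: "smooth_immersion A \<phi>"
begin

lemma is_chart: "(U, c) \<in> A \<Longrightarrow> is_chart M (U, c)"
  using manifold by (auto simp: smooth_manifold_with_boundary_def)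

lemma covered:
  assumes "p \<in> topspace M" obtains U c where "(U, c) \<in> A" "p \<in> U"
proof -
  have "p \<in> (\<Union>(U, c)\<in>A. U)"
    using assms manifold unfolding smooth_manifold_with_boundary_def by simp
  then show ?thesis using that by auto
qed

lemma chart_domain: "(U, c) \<in> A \<Longrightarrow> openin M U"
  using is_chart by (auto simp: is_chart_def)

lemma chart_domain_subset: "(U, c) \<in> A \<Longrightarrow> U \<subseteq> topspace M"
  using chart_domain openin_subset by blast

lemma chart_image: "(U, c) \<in> A \<Longrightarrow> openin (top_of_set half_space) (c ` U)"
  using is_chart by (auto simp: is_chart_def)

lemma chart_homeo: "(U, c) \<in> A \<Longrightarrow> homeomorphic_map (subtopology M U) (top_of_set (c ` U)) c"
  using is_chart by (auto simp: is_chart_def)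

lemma inj_chart:
  assumes "(U, c) \<in> A" shows "inj_on c U"
  using homeomorphic_imp_injective_map[OF chart_homeo[OF assms]] chart_domain_subset[OF assms]
  by (simp add: Int_absorb1)

lemma local_param_chart: "(U, c) \<in> A \<Longrightarrow> p \<in> U \<Longrightarrow> local_param \<phi> (U, c) (c p) = \<phi> p"
  using inj_chart[of U c] by (simp add: local_param_def)

lemma openin_chart_preimage:
  assumes "(U, c) \<in> A" "open T" shows "openin M {p \<in> U. c p \<in> T}"
proof -
  have "continuous_map (subtopology M U) euclidean c"
    using homeomorphic_imp_continuous_map[OF chart_homeo[OF assms(1)]] continuous_map_into_fulltopology by blast
  from openin_continuous_map_preimage[OF this, of T]
  have "openin (subtopology M U) {p \<in> U. c p \<in> T}"
    using assms(2) chart_domain_subset[OF assms(1)] by (simp add: Int_absorb1)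
  then show ?thesis using chart_domain[OF assms(1)] by (simp add: openin_open_subtopology)
qed

lemma openin_chart_image:
  assumes "(U, c) \<in> A" "openin M W" shows "openin (top_of_set half_space) (c ` (U \<inter> W))"
proof -
  have "openin (subtopology M U) (U \<inter> W)"
    using assms(2) by (auto simp: openin_subtopology)
  then have "openin (top_of_set (c ` U)) (c ` (U \<inter> W))"
    using homeomorphic_imp_open_map[OF chart_homeo[OF assms(1)]] by (simp add: open_map_def)
  then show ?thesis using chart_image[OF assms(1)] openin_trans by blast
qed

lemma immersed_patch: "(U, c) \<in> A \<Longrightarrow> immersed_patch (c ` U) (local_param \<phi> (U, c))"
  using immersion by unfold_locales (auto simp: smooth_immersion_def chart_differential_def)

lemma continuous_immersion: "continuous_map M euclidean \<phi>"
  unfolding continuous_map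
proof (intro conjI allI impI)
  fix W :: "'b set" assume W: "openin euclidean W"
  show "openin M {p \<in> topspace M. \<phi> p \<in> W}"
  proof (subst openin_subopen, intro ballI)
    fix p assume "p \<in> {p \<in> topspace M. \<phi> p \<in> W}"
    then obtain U c where Uc: "(U, c) \<in> A" "p \<in> U" and p: "\<phi> p \<in> W" using covered by blast
    interpret immersed_patch "c ` U" "local_param \<phi> (U, c)" by (rule immersed_patch[OF Uc(1)])
    obtain T where T: "open T" "c ` U \<inter> local_param \<phi> (U, c) -` W = c ` U \<inter> T"
      using continuous_openin_preimage_gen[OF continuous_X, of W] W by (auto simp: openin_open)
    have iff: "c p' \<in> T \<longleftrightarrow> \<phi> p' \<in> W" if "p' \<in> U" for p'
    proof -
      have "c p' \<in> c ` U \<inter> local_param \<phi> (U, c) -` W \<longleftrightarrow> c p' \<in> c ` U \<inter> T" using T(2) by simp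
      then show ?thesis using that local_param_chart[OF Uc(1) that] by simp
    qed
    show "\<exists>T. openin M T \<and> p \<in> T \<and> T \<subseteq> {p \<in> topspace M. \<phi> p \<in> W}"
      using openin_chart_preimage[OF Uc(1) T(1)] iff Uc p chart_domain_subset[OF Uc(1)]
      by (intro exI[of _ "{p' \<in> U. c p' \<in> T}"]) auto
  qed
qed auto

end

text \<open>At the maximum of a linear function a boundary point is handled by the Hopf lemma, so the
  maximum set is open.\<close>

lemma linear_function_constant:
  fixes \<phi> :: "'m \<Rightarrow> (real ^ 'n::finite) \<times> real"
  assumes "smooth_manifold_with_boundary M A" "smooth_immersion A \<phi>" and minimal: "minimal_immersion A \<phi>"
    and M: "compact_space M" "connected_space M" "topspace M \<noteq> {}"
    and bd: "\<And>p. p \<in> manifold_boundary A \<Longrightarrow> \<exists>\<eta>. is_outward_unit_conormal A \<phi> p \<eta> \<and> \<eta> \<bullet> a \<le> 0"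
  obtains m where "\<And>p. p \<in> topspace M \<Longrightarrow> \<phi> p \<bullet> a = m"
proof -
  interpret immersed_manifold M A \<phi> using assms by unfold_locales
  have patch: "minimal_patch (c ` U) (local_param \<phi> (U, c))" if "(U, c) \<in> A" for U c
  proof -
    interpret immersed_patch "c ` U" "local_param \<phi> (U, c)" by (rule immersed_patch[OF that])
    show ?thesis using minimal that
      by unfold_locales (fastforce simp: minimal_immersion_def is_unit_normal_def chart_differential_def)
  qed
  have "compact (\<phi> ` topspace M)"
    using image_compactin[OF _ continuous_immersion] M(1) by (simp add: compact_space_def)
  moreover have "continuous_on (\<phi> ` topspace M) (\<lambda>x. x \<bullet> a)" by (intro continuous_intros)
  moreover have "\<phi> ` topspace M \<noteq> {}" using M(3) by blast
  ultimately have "\<exists>x\<in>\<phi> ` topspace M. \<forall>y\<in>\<phi> ` topspace M. y \<bullet> a \<le> x \<bullet> a"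
    by (intro continuous_attains_sup)
  then obtain p0 where p0: "p0 \<in> topspace M" "\<And>p. p \<in> topspace M \<Longrightarrow> \<phi> p \<bullet> a \<le> \<phi> p0 \<bullet> a"
    by blast
  define m where "m = \<phi> p0 \<bullet> a"
  define K where "K = {p \<in> topspace M. \<phi> p \<bullet> a = m}"
  have "closedin M K"
  proof -
    have "closed {x. x \<bullet> a = m}" by (intro closed_Collect_eq continuous_intros)
    then show ?thesis unfolding K_def
      using closedin_continuous_map_preimage[OF continuous_immersion, of "{x. x \<bullet> a = m}"] by simp
  qed
  moreover have "openin M K"
  proof (subst openin_subopen, intro ballI)
    fix p assume "p \<in> K"
    then have p: "p \<in> topspace M" "\<phi> p \<bullet> a = m" by (auto simp: K_def)
    have "\<exists>U c e. (U, c) \<in> A \<and> p \<in> U \<and> e > 0 \<and> (\<forall>y\<in>c ` U \<inter> ball (c p) e. local_param \<phi> (U, c) y \<bullet> a = m)"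
    proof (cases "p \<in> manifold_boundary A")
      case True
      \<comment> \<open>The chart is the one in which the conormal is expressed, since there the
        outward coordinate vector \<open>v\<close> is known.\<close>
      then obtain \<eta> U c v where Uc: "(U, c) \<in> A" "p \<in> U" and cp: "c p $ bd_coord = 0"
        and v: "v $ bd_coord < 0" "\<eta> = chart_differential \<phi> (U, c) p v" "\<eta> \<bullet> a \<le> 0"
        using bd unfolding is_outward_unit_conormal_def by blast
      interpret minimal_patch "c ` U" "local_param \<phi> (U, c)" by (rule patch[OF Uc(1)])
      have "\<exists>e>0. \<forall>y\<in>c ` U \<inter> ball (c p) e. local_param \<phi> (U, c) y \<bullet> a = m"
      proof (rule boundary_maximum_principle[OF chart_image[OF Uc(1)] _ cp _ _ v(1)])
        show "c p \<in> c ` U" using Uc by blast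
        show "local_param \<phi> (U, c) (c p) \<bullet> a = m" using local_param_chart[OF Uc] p by simp
        show "frechet_derivative (local_param \<phi> (U, c)) (at (c p) within c ` U) v \<bullet> a \<le> 0"
          using v by (simp add: chart_differential_def)
        show "local_param \<phi> (U, c) y \<bullet> a \<le> m" if "y \<in> c ` U" for y
          using that p0(2) local_param_chart[OF Uc(1)] chart_domain_subset[OF Uc(1)] by (auto simp: m_def)
      qed
      then show ?thesis using Uc by blast
    next
      case False
      obtain U c where Uc: "(U, c) \<in> A" "p \<in> U" using covered[OF p(1)] by blast
      interpret minimal_patch "c ` U" "local_param \<phi> (U, c)" by (rule patch[OF Uc(1)])
      have "c p \<in> half_space" using chart_image[OF Uc(1)] Uc(2) openin_imp_subset by blast
      moreover have "c p $ bd_coord \<noteq> 0" using False Uc by (auto simp: manifold_boundary_def)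
      ultimately have "c p \<in> {u. 0 < u $ bd_coord}" by (simp add: half_space_def)
      then obtain e1 where e1: "e1 > 0" "ball (c p) e1 \<subseteq> {u. 0 < u $ bd_coord}"
        using open_half open_contains_ball by blast
      obtain e2 where e2: "e2 > 0" "ball (c p) e2 \<inter> half_space \<subseteq> c ` U"
        using chart_image[OF Uc(1)] Uc(2) unfolding openin_contains_ball by blast
      define e where "e = min e1 e2"
      have e: "e > 0" using e1 e2 by (simp add: e_def)
      have sub: "ball (c p) e \<subseteq> c ` U"
      proof
        fix y assume "y \<in> ball (c p) e"
        then have "y \<in> ball (c p) e1" "y \<in> ball (c p) e2" by (auto simp: e_def)
        then show "y \<in> c ` U" using e1(2) e2(2) by (force simp: half_space_def)
      qed
      have "local_param \<phi> (U, c) y \<bullet> a = m" if "y \<in> ball (c p) e" for y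
      proof (rule strong_maximum_principle[OF open_ball connected_ball sub _ _ _ that])
        show "c p \<in> ball (c p) e" using e by simp
        show "local_param \<phi> (U, c) (c p) \<bullet> a = m" using local_param_chart[OF Uc] p by simp
        show "local_param \<phi> (U, c) y \<bullet> a \<le> m" if "y \<in> ball (c p) e" for y
          using that sub p0(2) local_param_chart[OF Uc(1)] chart_domain_subset[OF Uc(1)] by (force simp: m_def)
      qed
      then show ?thesis using Uc e by blast
    qed
    then obtain U c e where Uc: "(U, c) \<in> A" "p \<in> U" and e: "e > 0"
      "\<And>y. y \<in> c ` U \<inter> ball (c p) e \<Longrightarrow> local_param \<phi> (U, c) y \<bullet> a = m" by blast
    have "{p' \<in> U. c p' \<in> ball (c p) e} \<subseteq> K"
    proof
      fix p' assume "p' \<in> {p' \<in> U. c p' \<in> ball (c p) e}"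
      then have p': "p' \<in> U" "c p' \<in> ball (c p) e" by auto
      then show "p' \<in> K"
        using e(2)[of "c p'"] local_param_chart[OF Uc(1) p'(1)] chart_domain_subset[OF Uc(1)]
        by (auto simp: K_def)
    qed
    then show "\<exists>T. openin M T \<and> p \<in> T \<and> T \<subseteq> K"
      using openin_chart_preimage[OF Uc(1) open_ball, of "c p" e] Uc e(1)
      by (intro exI[of _ "{p' \<in> U. c p' \<in> ball (c p) e}"]) auto
  qed
  moreover have "p0 \<in> K" using p0 by (simp add: K_def m_def)
  ultimately have "K = topspace M" using M(2) unfolding connected_space_clopen_in by blast
  then show ?thesis using that[of m] by (auto simp: K_def)
qed

section \<open>Local homeomorphisms onto convex sets\<close>

text \<open>Local sections of \<open>\<psi>\<close> exist over balls of a uniform radius. Contracting the convex target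
  to a point \<open>x0\<close> in small steps and lifting each step by these sections gives a continuous
  retraction onto the fibre over \<open>x0\<close>; the fibre is discrete, so it is a single point.\<close>

lemma local_homeo_to_convex_inj:
  fixes \<psi> :: "'m \<Rightarrow> 'a::real_normed_vector"
  assumes M: "compact_space M" "connected_space M" "Hausdorff_space M" and B: "convex B"
    and cont: "continuous_map M (top_of_set B) \<psi>" and om: "open_map M (top_of_set B) \<psi>"
    and linj: "\<And>p. p \<in> topspace M \<Longrightarrow> \<exists>V. openin M V \<and> p \<in> V \<and> inj_on \<psi> V"
  shows "inj_on \<psi> (topspace M)"
proof (cases "topspace M = {}")
  case True
  then show ?thesis by simp
next
  case ne: False
  have \<psi>B: "\<psi> p \<in> B" if "p \<in> topspace M" for p
    using continuous_map_funspace[OF cont] that by auto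
  have omD: "openin (top_of_set B) (\<psi> ` U)" if "openin M U" for U
    using om that by (simp add: open_map_def)
  have "\<exists>V \<epsilon>. openin M V \<and> p \<in> V \<and> inj_on \<psi> V \<and> \<epsilon> > 0 \<and> ball (\<psi> p) (2 * \<epsilon>) \<inter> B \<subseteq> \<psi> ` V"
    if p: "p \<in> topspace M" for p
  proof -
    obtain V where V: "openin M V" "p \<in> V" "inj_on \<psi> V" using linj[OF p] by blast
    obtain e where "e > 0" "ball (\<psi> p) e \<inter> B \<subseteq> \<psi> ` V"
      using omD[OF V(1)] V(2) unfolding openin_contains_ball by blast
    then show ?thesis using V by (intro exI[of _ V] exI[of _ "e/2"]) auto
  qed
  then obtain V \<epsilon> where V: "\<And>p. p \<in> topspace M \<Longrightarrow> openin M (V p)" "\<And>p. p \<in> topspace M \<Longrightarrow> p \<in> V p"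
    "\<And>p. p \<in> topspace M \<Longrightarrow> inj_on \<psi> (V p)" "\<And>p. p \<in> topspace M \<Longrightarrow> \<epsilon> p > (0::real)"
    "\<And>p. p \<in> topspace M \<Longrightarrow> ball (\<psi> p) (2 * \<epsilon> p) \<inter> B \<subseteq> \<psi> ` V p"
    by metis
  \<comment> \<open>Radius \<open>\<epsilon> p\<close> here against \<open>2 * \<epsilon> p\<close>
    above: for \<open>x\<close> in \<open>W p\<close>, the part in \<open>B\<close> of the ball of
    radius \<open>\<epsilon> p\<close> about \<open>\<psi> x\<close> still lies in the image of
    \<open>V p\<close>. After passing to a finite subcover, \<open>\<delta>\<close> serves all
    points at once.\<close>
  define W where "W p = V p \<inter> {x \<in> topspace M. \<psi> x \<in> ball (\<psi> p) (\<epsilon> p)}" for p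
  have contE: "continuous_map M euclidean \<psi>"
    using cont continuous_map_into_fulltopology by blast
  have oW: "openin M (W p)" if "p \<in> topspace M" for p
    unfolding W_def using V(1)[OF that] openin_continuous_map_preimage[OF contE, of "ball (\<psi> p) (\<epsilon> p)"]
    by (intro openin_Int) auto
  have "topspace M \<subseteq> \<Union>(W ` topspace M)" using V(2,4) by (auto simp: W_def)
  moreover have "\<forall>U\<in>W ` topspace M. openin M U" using oW by blast
  ultimately have "\<exists>\<F>. finite \<F> \<and> \<F> \<subseteq> W ` topspace M \<and> topspace M \<subseteq> \<Union>\<F>"
    using M(1) unfolding compact_space_alt by blast
  then obtain F where F: "finite F" "F \<subseteq> topspace M" "topspace M \<subseteq> (\<Union>p\<in>F. W p)"
    by (metis finite_subset_image)
  have Fne: "F \<noteq> {}" using F ne by auto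
  define \<delta> where "\<delta> = Min (\<epsilon> ` F)"
  have \<delta>: "\<delta> > 0" "\<And>i. i \<in> F \<Longrightarrow> \<delta> \<le> \<epsilon> i"
    using F Fne V(4) by (auto simp: \<delta>_def)
  define \<sigma> where "\<sigma> i = inv_into (V i) \<psi>" for i
  have \<sigma>: "\<sigma> i x \<in> V i" "\<psi> (\<sigma> i x) = x" if "x \<in> \<psi> ` V i" for i x
    using that by (auto simp: \<sigma>_def inv_into_into f_inv_into_f)
  have \<sigma>\<psi>: "\<sigma> i (\<psi> p) = p" if "i \<in> F" "p \<in> V i" for i p
    using that V(3)[of i] F by (auto simp: \<sigma>_def)
  have near: "ball (\<psi> p) \<delta> \<inter> B \<subseteq> \<psi> ` V i" if "i \<in> F" "p \<in> W i" for i p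
  proof
    fix x assume x: "x \<in> ball (\<psi> p) \<delta> \<inter> B"
    have "dist (\<psi> i) x \<le> dist (\<psi> i) (\<psi> p) + dist (\<psi> p) x" by (rule dist_triangle)
    then have "x \<in> ball (\<psi> i) (2 * \<epsilon> i) \<inter> B"
      using x that \<delta>(2)[OF that(1)] by (auto simp: W_def)
    then show "x \<in> \<psi> ` V i" using V(5) that F by blast
  qed
  \<comment> \<open>Two local sections through the same point agree on all of \<open>C\<close>,
    which is convex and hence connected: the agreement set is open because \<open>\<psi>\<close> is
    open and the sections invert it, and its complement is open because \<open>M\<close> is
    Hausdorff.\<close>
  have consistent: "\<sigma> i x = \<sigma> j x"
    if ij: "i \<in> F" "j \<in> F" "p \<in> W i" "p \<in> W j" and x: "x \<in> ball (\<psi> p) \<delta> \<inter> B" for i j p x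
  proof -
    define C where "C = ball (\<psi> p) \<delta> \<inter> B"
    have "connected C" unfolding C_def by (intro convex_connected convex_Int convex_ball B)
    define T where "T = {x \<in> C. \<sigma> i x = \<sigma> j x}"
    have CB: "C \<subseteq> B" by (auto simp: C_def)
    have CV: "C \<subseteq> \<psi> ` V i" "C \<subseteq> \<psi> ` V j" using near ij by (auto simp: C_def)
    have oV: "openin M (V i)" "openin M (V j)" using V(1) ij F by auto
    have restrict: "openin (top_of_set C) (C \<inter> U)" if "openin (top_of_set B) U" for U
      using that CB by (auto simp: openin_open)
    have "T = C \<inter> \<psi> ` (V i \<inter> V j)"
    proof (intro set_eqI iffI)
      fix y assume y: "y \<in> T"
      then have "y \<in> \<psi> ` V i" "y \<in> \<psi> ` V j" "\<sigma> i y = \<sigma> j y" using CV by (auto simp: T_def)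
      then have "\<sigma> i y \<in> V i \<inter> V j" "y = \<psi> (\<sigma> i y)" using \<sigma>[of y i] \<sigma>(1)[of y j] by auto
      then show "y \<in> C \<inter> \<psi> ` (V i \<inter> V j)" using y by (auto simp: T_def)
    next
      fix y assume "y \<in> C \<inter> \<psi> ` (V i \<inter> V j)"
      then obtain a where "y = \<psi> a" "a \<in> V i" "a \<in> V j" "y \<in> C" by blast
      then show "y \<in> T" using \<sigma>\<psi>[OF ij(1)] \<sigma>\<psi>[OF ij(2)] by (simp add: T_def)
    qed
    then have "openin (top_of_set C) T" using restrict omD oV by (metis openin_Int)
    moreover have "openin (top_of_set C) (C - T)"
    proof (subst openin_subopen, intro ballI)
      fix y assume y: "y \<in> C - T"
      then have yV: "y \<in> \<psi> ` V i" "y \<in> \<psi> ` V j" and neq: "\<sigma> i y \<noteq> \<sigma> j y" using CV by (auto simp: T_def)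
      have "\<sigma> i y \<in> topspace M" "\<sigma> j y \<in> topspace M" using \<sigma> yV oV openin_subset by blast+
      then obtain P Q where PQ: "openin M P" "openin M Q" "\<sigma> i y \<in> P" "\<sigma> j y \<in> Q" "disjnt P Q"
        using M(3) neq unfolding Hausdorff_space_def by metis
      define R where "R = C \<inter> (\<psi> ` (V i \<inter> P) \<inter> \<psi> ` (V j \<inter> Q))"
      have "openin (top_of_set C) R"
        unfolding R_def by (intro restrict openin_Int omD oV PQ)
      moreover have "y \<in> R"
      proof -
        have "y \<in> \<psi> ` (V i \<inter> P)" using \<sigma>[OF yV(1)] PQ by (intro image_eqI[of _ _ "\<sigma> i y"]) auto
        moreover have "y \<in> \<psi> ` (V j \<inter> Q)" using \<sigma>[OF yV(2)] PQ by (intro image_eqI[of _ _ "\<sigma> j y"]) auto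
        ultimately show ?thesis using y by (simp add: R_def)
      qed
      moreover have "R \<subseteq> C - T"
      proof
        fix w assume w: "w \<in> R"
        then obtain a b where ab: "a \<in> V i" "a \<in> P" "w = \<psi> a" "b \<in> V j" "b \<in> Q" "w = \<psi> b"
          by (auto simp: R_def)
        have "\<sigma> i w = a" "\<sigma> j w = b" using ab \<sigma>\<psi> ij by metis+
        then show "w \<in> C - T" using ab PQ w by (auto simp: R_def T_def disjnt_iff)
      qed
      ultimately show "\<exists>R. openin (top_of_set C) R \<and> y \<in> R \<and> R \<subseteq> C - T" by blast
    qed
    then have "closedin (top_of_set C) T" by (auto simp: closedin_def T_def)
    ultimately have "T = {} \<or> T = C" using \<open>connected C\<close> unfolding connected_clopen by blast
    moreover have "\<psi> p \<in> T"
    proof -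
      have "p \<in> topspace M" using ij(3) by (simp add: W_def)
      moreover have "p \<in> V i" "p \<in> V j" using ij by (simp_all add: W_def)
      then have "\<sigma> i (\<psi> p) = \<sigma> j (\<psi> p)" using \<sigma>\<psi>[OF ij(1)] \<sigma>\<psi>[OF ij(2)] by simp
      ultimately show ?thesis using \<delta>(1) \<psi>B by (simp add: T_def C_def)
    qed
    ultimately have "T = C" by blast
    then have "x \<in> T" using x by (simp only: C_def)
    then show ?thesis unfolding T_def by blast
  qed
  obtain idx where idx: "\<And>p. p \<in> topspace M \<Longrightarrow> idx p \<in> F \<and> p \<in> W (idx p)"
    using F(3) by (metis UN_E subsetD)
  show ?thesis
  proof (rule inj_onI)
    fix p q assume p: "p \<in> topspace M" and q: "q \<in> topspace M" and pq: "\<psi> p = \<psi> q"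
    define x0 where "x0 = \<psi> p"
    have x0B: "x0 \<in> B" using \<psi>B p by (simp add: x0_def)
    have "compact (\<psi> ` topspace M)"
      using image_compactin[OF _ contE] M(1) by (simp add: compact_space_def)
    then obtain D0 where D0: "\<forall>y\<in>\<psi> ` topspace M. dist x0 y \<le> D0"
      using compact_imp_bounded bounded_any_center by blast
    define D where "D = max D0 1"
    have D: "D > 0" "\<And>r. r \<in> topspace M \<Longrightarrow> dist x0 (\<psi> r) \<le> D"
      using D0 by (auto simp: D_def le_max_iff_disj)
    obtain N :: nat where N: "D / \<delta> < N" using reals_Archimedean2 by blast
    have N0: "N > 0" using N D(1) \<delta>(1) by (metis divide_pos_pos gr0I of_nat_0 order_less_asym)
    have DN: "D / N < \<delta>" using N N0 \<delta>(1) by (simp add: field_simps)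
    \<comment> \<open>Stage \<open>k\<close> of \<open>N\<close> in the contraction of
      \<open>B\<close> to \<open>x0\<close>: \<open>c 0\<close> is the identity, \<open>c N\<close>
      is constant, and one stage moves a point of the image by at most
      \<open>D / N < \<delta>\<close>, within reach of a local section.\<close>
    define c where "c k x = x0 + (1 - real k / real N) *\<^sub>R (x - x0)" for k x
    have cB: "c k x \<in> B" if "x \<in> B" "k \<le> N" for k x
    proof -
      have "c k x = (real k / real N) *\<^sub>R x0 + (1 - real k / real N) *\<^sub>R x"
        by (simp add: c_def algebra_simps)
      then show ?thesis using convexD[OF B x0B that(1), of "real k / real N" "1 - real k / real N"] that N0 by auto
    qed
    have cstep: "dist (c k x) (c (Suc k) x) = dist x0 x / real N" for k x
    proof -
      have "c k x - c (Suc k) x = ((1 - real k / real N) - (1 - real (Suc k) / real N)) *\<^sub>R (x - x0)"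
        by (simp add: c_def scaleR_diff_left)
      also have "(1 - real k / real N) - (1 - real (Suc k) / real N) = 1 / real N"
        using N0 by (simp add: field_simps)
      finally show ?thesis using N0 by (simp add: dist_norm norm_minus_commute)
    qed
    \<comment> \<open>Each stage lifts the next target by the section chosen at the current
      position. The choice \<open>idx\<close> need not be continuous, but \<open>consistent\<close>
      allows it to be replaced by a fixed index near any given point. Points over \<open>x0\<close>
      never move.\<close>
    define e where "e = rec_nat (\<lambda>r. r) (\<lambda>k g r. \<sigma> (idx (g r)) (c (Suc k) (\<psi> r)))"
    have e0: "e 0 r = r" and eS: "e (Suc k) r = \<sigma> (idx (e k r)) (c (Suc k) (\<psi> r))" for k r
      by (simp_all add: e_def)
    have e: "k \<le> N \<Longrightarrow> continuous_map M M (e k) \<and> (\<forall>r\<in>topspace M. \<psi> (e k r) = c k (\<psi> r)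
       \<and> (\<psi> r = x0 \<longrightarrow> e k r = r))" for k
    proof (induction k)
      case 0
      have "e 0 = (\<lambda>r. r)" using e0 by auto
      then show ?case by (simp add: c_def)
    next
      case (Suc k)
      then have ck: "continuous_map M M (e k)" and ek: "\<And>r. r \<in> topspace M \<Longrightarrow> \<psi> (e k r) = c k (\<psi> r)"
        "\<And>r. r \<in> topspace M \<Longrightarrow> \<psi> r = x0 \<Longrightarrow> e k r = r" by auto
      have eM: "e k r \<in> topspace M" if "r \<in> topspace M" for r
        using continuous_map_funspace[OF ck] that by auto
      have inb: "c (Suc k) (\<psi> r) \<in> ball (\<psi> (e k r)) \<delta> \<inter> B" if r: "r \<in> topspace M" for r
      proof -
        have "dist x0 (\<psi> r) / real N \<le> D / real N" using D(2)[OF r] by (simp add: divide_right_mono)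
        then have "dist (\<psi> (e k r)) (c (Suc k) (\<psi> r)) < \<delta>" using ek(1)[OF r] cstep DN by simp
        then show ?thesis using cB \<psi>B r Suc.prems by auto
      qed
      have inV: "c (Suc k) (\<psi> r) \<in> \<psi> ` V (idx (e k r))" if "r \<in> topspace M" for r
        using near inb[OF that] idx[OF eM[OF that]] by blast
      have "continuous_map M M (e (Suc k))"
        unfolding continuous_map
      proof (intro conjI allI impI)
        show "e (Suc k) ` topspace M \<subseteq> topspace M"
        proof clarify
          fix r assume r: "r \<in> topspace M"
          have "e (Suc k) r \<in> V (idx (e k r))" using \<sigma>(1)[OF inV[OF r]] by (simp add: eS)
          then show "e (Suc k) r \<in> topspace M"
            using V(1) idx[OF eM[OF r]] F(2) openin_subset by blast
        qed
        fix U assume U: "openin M U"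
        show "openin M {r \<in> topspace M. e (Suc k) r \<in> U}"
        proof (subst openin_subopen, intro ballI)
          fix r assume "r \<in> {r \<in> topspace M. e (Suc k) r \<in> U}"
          then have r: "r \<in> topspace M" "e (Suc k) r \<in> U" by auto
          define i where "i = idx (e k r)"
          have i: "i \<in> F" "i \<in> topspace M" "e k r \<in> W i" using idx[OF eM[OF r(1)]] F by (auto simp: i_def)
          define P where "P = {r' \<in> topspace M. e k r' \<in> W i}"
          \<comment> \<open>On \<open>P\<close> the index may be fixed as \<open>i\<close>. On
            \<open>Q\<close> the next target has a lift in \<open>U \<inter> V i\<close>, and
            injectivity on \<open>V i\<close> identifies that lift with the value of the
            section.\<close>
          define Q where "Q = {r' \<in> topspace M. c (Suc k) (\<psi> r') \<in> \<psi> ` (U \<inter> V i)}"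
          have "openin M P" unfolding P_def by (rule openin_continuous_map_preimage[OF ck oW[OF i(2)]])
          moreover have "openin M Q" unfolding Q_def
          proof (rule openin_continuous_map_preimage)
            have "continuous_map (top_of_set B) (top_of_set B) (c (Suc k))"
            proof -
              have "continuous_on B (c (Suc k))"
                unfolding c_def[abs_def] by (intro continuous_intros)
              moreover have "c (Suc k) \<in> B \<rightarrow> B" using cB Suc.prems by blast
              ultimately show ?thesis by (simp add: continuous_map_in_subtopology image_subset_iff_funcset)
            qed
            from continuous_map_compose[OF cont this]
            show "continuous_map M (top_of_set B) (\<lambda>r'. c (Suc k) (\<psi> r'))" by (simp add: o_def)
            show "openin (top_of_set B) (\<psi> ` (U \<inter> V i))" using omD U V(1) i by blast
          qed
          ultimately have "openin M (P \<inter> Q)" by blast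
          moreover have "r \<in> P \<inter> Q"
          proof -
            have "\<psi> (e (Suc k) r) = c (Suc k) (\<psi> r)" "e (Suc k) r \<in> V i"
              using \<sigma>[OF inV[OF r(1)]] by (simp_all add: eS i_def)
            then have "c (Suc k) (\<psi> r) \<in> \<psi> ` (U \<inter> V i)" using r(2) by (metis IntI imageI)
            then show ?thesis using r i by (simp add: P_def Q_def)
          qed
          moreover have "P \<inter> Q \<subseteq> {r \<in> topspace M. e (Suc k) r \<in> U}"
          proof
            fix r' assume "r' \<in> P \<inter> Q"
            then have r': "r' \<in> topspace M" "e k r' \<in> W i" and "c (Suc k) (\<psi> r') \<in> \<psi> ` (U \<inter> V i)"
              by (auto simp: P_def Q_def)
            then obtain u where u: "u \<in> U" "u \<in> V i" "c (Suc k) (\<psi> r') = \<psi> u" by blast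
            have "e (Suc k) r' = \<sigma> i (c (Suc k) (\<psi> r'))"
              unfolding eS using idx[OF eM[OF r'(1)]] i(1) r'(2) inb[OF r'(1)]
              by (intro consistent[of _ _ "e k r'"]) auto
            also have "\<dots> = u" using u \<sigma>\<psi> i by simp
            finally show "r' \<in> {r \<in> topspace M. e (Suc k) r \<in> U}" using u r' by simp
          qed
          ultimately show "\<exists>T. openin M T \<and> r \<in> T \<and> T \<subseteq> {r \<in> topspace M. e (Suc k) r \<in> U}" by blast
        qed
      qed
      moreover have "\<psi> (e (Suc k) r) = c (Suc k) (\<psi> r)" if "r \<in> topspace M" for r
        using \<sigma>(2)[OF inV[OF that]] by (simp add: eS)
      moreover have "e (Suc k) r = r" if "r \<in> topspace M" "\<psi> r = x0" for r
      proof -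
        have "c (Suc k) (\<psi> r) = \<psi> r" using that by (simp add: c_def)
        then show ?thesis using idx[OF that(1)] ek(2)[OF that] \<sigma>\<psi> by (simp add: eS W_def)
      qed
      ultimately show ?case by blast
    qed
    have cN: "continuous_map M M (e N)" and eN: "\<And>r. r \<in> topspace M \<Longrightarrow> \<psi> (e N r) = x0"
      "e N p = p" "e N q = q"
      using e[of N] p q pq N0 by (auto simp: c_def x0_def)
    have eNM: "e N r \<in> topspace M" if "r \<in> topspace M" for r
      using continuous_map_funspace[OF cN] that by auto
    \<comment> \<open>\<open>e N\<close> takes values in the fibre over \<open>x0\<close>, and
      \<open>V p\<close> meets that fibre only in \<open>p\<close>; so the set where
      \<open>e N\<close> equals \<open>p\<close> is open and closed and contains \<open>p\<close>.
      It is therefore everything, while \<open>e N q = q\<close>.\<close>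
    define A where "A = {r \<in> topspace M. e N r \<in> V p}"
    have Aeq: "e N r = p" if "r \<in> A" for r
      using that eN(1)[of r] V(2,3)[OF p] by (auto simp: A_def x0_def dest: inj_onD)
    have "openin M A" unfolding A_def by (rule openin_continuous_map_preimage[OF cN V(1)[OF p]])
    moreover have "closedin M A"
    proof -
      have "closedin M {p}" using M(3) p by (simp add: closedin_Hausdorff_sing_eq)
      moreover have "A = {r \<in> topspace M. e N r \<in> {p}}" using Aeq V(2)[OF p] by (auto simp: A_def)
      ultimately show ?thesis using closedin_continuous_map_preimage[OF cN, of "{p}"] by simp
    qed
    moreover have "p \<in> A" using p V(2) eN by (simp add: A_def)
    ultimately have "A = topspace M" using M(2) unfolding connected_space_clopen_in by blast
    then show "p = q" using Aeq[of q] q eN by simp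
  qed
qed

section \<open>Flat immersions\<close>

text \<open>The situation once the height is constant: the projection \<open>\<psi>\<close> maps
  between spaces of equal dimension, so invariance of domain applies in the interior.
  \<open>R\<close> will be \<open>f t\<close>.\<close>

locale flat_immersion = immersed_manifold M A \<phi>
  for M :: "'m topology" and A :: "('m, 'n::finite) chart set" and \<phi> :: "'m \<Rightarrow> (real ^ 'n) \<times> real" +
  fixes t R :: real
  assumes height: "\<And>p. p \<in> topspace M \<Longrightarrow> snd (\<phi> p) = t"
    and R: "R > 0"
    and norm_le: "\<And>p. p \<in> topspace M \<Longrightarrow> norm (fst (\<phi> p)) \<le> R"
    and norm_boundary: "\<And>p. p \<in> manifold_boundary A \<Longrightarrow> norm (fst (\<phi> p)) = R"
begin

abbreviation "\<psi> \<equiv> \<lambda>p. fst (\<phi> p)"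

abbreviation "Y U c \<equiv> \<lambda>u. fst (local_param \<phi> (U, c) u)"

lemma Y_chart: "(U, c) \<in> A \<Longrightarrow> p \<in> U \<Longrightarrow> Y U c (c p) = \<psi> p"
  by (simp add: local_param_chart)

lemma Y_norm: "(U, c) \<in> A \<Longrightarrow> u \<in> c ` U \<Longrightarrow> norm (Y U c u) \<le> R"
  using Y_chart norm_le chart_domain_subset by fastforce

lemma continuous_Y:
  assumes "(U, c) \<in> A" shows "continuous_on (c ` U) (Y U c)"
  using immersed_patch.continuous_X[OF immersed_patch[OF assms]] by (intro continuous_intros)

text \<open>A constant last coordinate contributes nothing to differences, so the projection
  inherits the lower bound.\<close>

lemma bilipschitz_Y:
  assumes Uc: "(U, c) \<in> A" and z: "z \<in> c ` U"
  obtains e l where "e > 0" "l > 0" "cball z e \<inter> half_space \<subseteq> c ` U"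
    "\<And>x y. x \<in> cball z e \<inter> half_space \<Longrightarrow> y \<in> cball z e \<inter> half_space \<Longrightarrow>
      l * norm (x - y) \<le> norm (Y U c x - Y U c y)"
proof -
  let ?X = "local_param \<phi> (U, c)"
  obtain e l where el: "e > 0" "l > 0" "cball z e \<inter> half_space \<subseteq> c ` U"
    "\<And>x y. x \<in> cball z e \<inter> half_space \<Longrightarrow> y \<in> cball z e \<inter> half_space \<Longrightarrow>
      l * norm (x - y) \<le> norm (?X x - ?X y)"
    using immersed_patch.bilipschitz[OF immersed_patch[OF Uc] z chart_image[OF Uc]] by blast
  have sndX: "snd (?X x) = t" if "x \<in> c ` U" for x
    using that local_param_chart[OF Uc] height chart_domain_subset[OF Uc] by auto
  have "norm (?X x - ?X y) = norm (Y U c x - Y U c y)" if "x \<in> c ` U" "y \<in> c ` U" for x y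
    using sndX[OF that(1)] sndX[OF that(2)] by (simp add: norm_prod_def)
  then show ?thesis using that[OF el(1-3)] el(3,4) by (metis (no_types, lifting) subsetD)
qed

text \<open>By invariance of domain a small piece of the interior around \<open>u\<close> has open
  image, and an open subset of the closed ball lies in its interior. The sphere can thus be reached
  only from boundary points.\<close>

lemma Y_interior:
  assumes Uc: "(U, c) \<in> A" and u: "u \<in> c ` U" "0 < u $ bd_coord"
  shows "norm (Y U c u) < R"
proof -
  obtain e l where el: "e > 0" "l > 0" "cball u e \<inter> half_space \<subseteq> c ` U"
    "\<And>x y. x \<in> cball u e \<inter> half_space \<Longrightarrow> y \<in> cball u e \<inter> half_space \<Longrightarrow>
      l * norm (x - y) \<le> norm (Y U c x - Y U c y)"
    using bilipschitz_Y[OF Uc u(1)] by blast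
  define G where "G = ball u e \<inter> {v. 0 < v $ bd_coord}"
  have sub: "G \<subseteq> cball u e \<inter> half_space" by (auto simp: G_def half_space_def)
  have "open (Y U c ` G)"
  proof (rule invariance_of_domain)
    show "continuous_on G (Y U c)" using continuous_Y[OF Uc] sub el(3) continuous_on_subset by blast
    show "open G" unfolding G_def by (intro open_Int open_half open_ball)
    show "inj_on (Y U c) G"
    proof (rule inj_onI)
      fix x y assume xy: "x \<in> G" "y \<in> G" "Y U c x = Y U c y"
      have "l * norm (x - y) \<le> norm (Y U c x - Y U c y)"
        using xy(1,2) sub by (intro el(4)) blast+
      then have "l * norm (x - y) \<le> 0" using xy(3) by simp
      then show "x = y" using el(2) by (simp add: mult_le_0_iff)
    qed
  qed
  moreover have "Y U c ` G \<subseteq> cball 0 R" using Y_norm[OF Uc] sub el(3) by auto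
  ultimately have "Y U c ` G \<subseteq> ball 0 R" by (metis interior_cball interior_maximal)
  moreover have "u \<in> G" using u el(1) by (simp add: G_def)
  ultimately show ?thesis by auto
qed

text \<open>At a boundary point the image of a neighbourhood is not open in the whole space. Instead
  a compact half-ball \<open>Q\<close> has closed image, and inside a connected part
  \<open>E\<close> of the open \<open>R\<close>-ball it coincides with the open image of the
  interior part \<open>G\<close>; being open, closed and nonempty in \<open>E\<close>, it is all of
  \<open>E\<close>. Closures add the points on the sphere.\<close>

lemma local_surjectivity:
  assumes W: "openin M W" "p \<in> W"
  obtains \<epsilon> where "\<epsilon> > 0" "ball (\<psi> p) \<epsilon> \<inter> cball 0 R \<subseteq> \<psi> ` W"
proof -
  have "p \<in> topspace M" using W openin_subset by blast
  then obtain U c where Uc: "(U, c) \<in> A" "p \<in> U" by (rule covered)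
  define z where "z = c p"
  have z: "z \<in> c ` U" using Uc by (simp add: z_def)
  have Yz: "Y U c z = \<psi> p" using Y_chart[OF Uc] by (simp add: z_def)
  obtain e1 l where el: "e1 > 0" "l > 0" "cball z e1 \<inter> half_space \<subseteq> c ` U"
    "\<And>x y. x \<in> cball z e1 \<inter> half_space \<Longrightarrow> y \<in> cball z e1 \<inter> half_space \<Longrightarrow>
      l * norm (x - y) \<le> norm (Y U c x - Y U c y)"
    using bilipschitz_Y[OF Uc(1) z] by blast
  have "z \<in> c ` (U \<inter> W)" using Uc W by (auto simp: z_def)
  then obtain e2 where e2: "e2 > 0" "ball z e2 \<inter> half_space \<subseteq> c ` (U \<inter> W)"
    using openin_chart_image[OF Uc(1) W(1)] unfolding openin_contains_ball by blast
  define e where "e = min e1 (e2/2)"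
  have e: "e > 0" "e \<le> e1" "e < e2" using el e2 by (auto simp: e_def)
  define Q where "Q = cball z e \<inter> half_space"
  have Q: "compact Q" unfolding Q_def by (intro compact_Int_closed compact_cball closed_half_space)
  have QW: "Q \<subseteq> c ` (U \<inter> W)" and Qe1: "Q \<subseteq> cball z e1 \<inter> half_space"
    using e e2(2) by (auto simp: Q_def)
  have QU: "Q \<subseteq> c ` U" using QW by blast
  have cY: "continuous_on Q (Y U c)" using continuous_Y[OF Uc(1)] QU continuous_on_subset by blast
  have clYQ: "closed (Y U c ` Q)" using compact_continuous_image[OF cY Q] compact_imp_closed by blast
  have zH: "z \<in> half_space" using z chart_image[OF Uc(1)] openin_imp_subset by blast
  have zQ: "z \<in> Q" using zH e by (simp add: Q_def)
  define G where "G = ball z e \<inter> {v. 0 < v $ bd_coord}"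
  have GQ: "G \<subseteq> Q" by (auto simp: G_def Q_def half_space_def)
  have oYG: "open (Y U c ` G)"
  proof (rule invariance_of_domain)
    show "continuous_on G (Y U c)" using cY GQ continuous_on_subset by blast
    show "open G" unfolding G_def by (intro open_Int open_half open_ball)
    show "inj_on (Y U c) G"
    proof (rule inj_onI)
      fix x y assume xy: "x \<in> G" "y \<in> G" "Y U c x = Y U c y"
      have "l * norm (x - y) \<le> norm (Y U c x - Y U c y)"
        using xy(1,2) GQ Qe1 by (intro el(4)) blast+
      then have "l * norm (x - y) \<le> 0" using xy(3) by simp
      then show "x = y" using el(2) by (simp add: mult_le_0_iff)
    qed
  qed
  \<comment> \<open>By the bilipschitz bound the radius \<open>l * e\<close> keeps preimages in
    \<open>Q\<close> of points of \<open>E\<close> off the outer sphere of \<open>Q\<close>;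
    \<open>ball 0 R\<close> excludes points of the manifold boundary, which go to the sphere. What
    remains is \<open>G\<close>.\<close>
  define E where "E = ball (\<psi> p) (l * e) \<inter> ball 0 R"
  have "connected E" unfolding E_def by (intro convex_connected convex_Int convex_ball)
  have YQE: "Y U c ` Q \<inter> E = Y U c ` G \<inter> E"
  proof
    show "Y U c ` Q \<inter> E \<subseteq> Y U c ` G \<inter> E"
    proof
      fix y assume "y \<in> Y U c ` Q \<inter> E"
      then obtain a where a: "a \<in> Q" "y = Y U c a" and y: "y \<in> E" by blast
      obtain p' where p': "p' \<in> U" "a = c p'" using a QU by blast
      have "norm (\<psi> p') < R" using y a Y_chart[OF Uc(1) p'(1)] p' by (simp add: E_def)
      then have "a $ bd_coord \<noteq> 0"
        using norm_boundary[of p'] p' Uc by (auto simp: manifold_boundary_def)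
      then have "0 < a $ bd_coord" using a by (simp add: Q_def half_space_def)
      moreover have "l * norm (a - z) \<le> norm (Y U c a - Y U c z)"
        using a(1) zQ Qe1 by (intro el(4)) auto
      then have "l * norm (a - z) < l * e"
        using y a Yz by (simp add: E_def dist_norm norm_minus_commute)
      then have "a \<in> ball z e" using el(2) by (simp add: dist_norm norm_minus_commute)
      ultimately show "y \<in> Y U c ` G \<inter> E" using a y by (auto simp: G_def)
    qed
  qed (use GQ in blast)
  have "openin (top_of_set E) (Y U c ` Q \<inter> E)"
    unfolding YQE using oYG by (auto simp: openin_open)
  moreover have "closedin (top_of_set E) (Y U c ` Q \<inter> E)"
    using clYQ by (auto simp: closedin_closed)
  \<comment> \<open>\<open>z\<close> itself may map to the sphere and miss \<open>E\<close>, so a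
    nearby point of \<open>G\<close> is used.\<close>
  moreover have "Y U c ` Q \<inter> E \<noteq> {}"
  proof -
    obtain d where d: "d > 0" "\<And>x. x \<in> Q \<Longrightarrow> dist x z < d \<Longrightarrow> dist (Y U c x) (Y U c z) < l * e"
      using cY zQ e(1) el(2) unfolding continuous_on_iff by (metis mult_pos_pos)
    have "z \<in> closure G"
      unfolding G_def using in_closure_half_ball[of z z e] zH e(1) by simp
    then obtain a where a: "a \<in> G" "dist a z < d" using d(1) unfolding closure_approachable by blast
    have aQ: "a \<in> Q" "0 < a $ bd_coord" using a(1) GQ by (auto simp: G_def)
    then have "norm (Y U c a) < R" using QU by (intro Y_interior[OF Uc(1)]) auto
    then have "Y U c a \<in> E" using d(2)[OF aQ(1) a(2)] Yz by (simp add: E_def dist_commute)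
    then show ?thesis using a GQ by blast
  qed
  ultimately have "Y U c ` Q \<inter> E = E" using \<open>connected E\<close> unfolding connected_clopen by blast
  then have "closure E \<subseteq> Y U c ` Q" using clYQ by (intro closure_minimal) auto
  moreover have "ball (\<psi> p) (l * e) \<inter> cball 0 R \<subseteq> closure E"
    using open_Int_closure_subset[of "ball (\<psi> p) (l * e)" "ball 0 R"] R by (simp add: E_def)
  moreover have "Y U c ` Q \<subseteq> \<psi> ` W"
  proof -
    have "Y U c ` c ` (U \<inter> W) \<subseteq> \<psi> ` W" using Y_chart[OF Uc(1)] by auto
    then show ?thesis using QW by blast
  qed
  ultimately show ?thesis using that[of "l * e"] el(2) e(1) by (meson mult_pos_pos subset_trans)
qed

text \<open>The projection is open and locally injective, hence injective by
  \<open>local_homeo_to_convex_inj\<close>; its image is open and closed in the closed ball, hence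
  all of it. A point over the sphere cannot be interior, which produces a boundary point.\<close>

lemma image_is_disk:
  assumes M: "compact_space M" "connected_space M" "topspace M \<noteq> {}"
  shows "inj_on \<phi> (topspace M)" "\<phi> ` topspace M = {(x, y). y = t \<and> norm x \<le> R}"
    "manifold_boundary A \<noteq> {}"
proof -
  have cont: "continuous_map M euclidean \<psi>"
    using continuous_map_compose[OF continuous_immersion, of euclidean fst]
    by (simp add: o_def continuous_on_fst continuous_on_id)
  have \<psi>B: "\<psi> ` topspace M \<subseteq> cball 0 R" using norm_le by auto
  have contB: "continuous_map M (top_of_set (cball 0 R)) \<psi>"
    using cont \<psi>B by (simp add: continuous_map_in_subtopology image_subset_iff_funcset)
  have om: "open_map M (top_of_set (cball 0 R)) \<psi>"
    unfolding open_map_def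
  proof (intro allI impI)
    fix W assume W: "openin M W"
    show "openin (top_of_set (cball 0 R)) (\<psi> ` W)"
      unfolding openin_contains_ball
    proof (intro conjI ballI)
      show "\<psi> ` W \<subseteq> cball 0 R" using \<psi>B openin_subset[OF W] by blast
      fix x assume "x \<in> \<psi> ` W"
      then show "\<exists>e>0. ball x e \<inter> cball 0 R \<subseteq> \<psi> ` W" using local_surjectivity[OF W] by blast
    qed
  qed
  have inj: "inj_on \<psi> (topspace M)"
  proof (rule local_homeo_to_convex_inj[OF M(1,2) _ convex_cball contB om])
    show "Hausdorff_space M" using manifold by (simp add: smooth_manifold_with_boundary_def)
    fix p assume "p \<in> topspace M"
    then obtain U c where Uc: "(U, c) \<in> A" "p \<in> U" by (rule covered)
    have "c p \<in> c ` U" using Uc by blast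
    then obtain e l where el: "e > 0" "l > 0" "cball (c p) e \<inter> half_space \<subseteq> c ` U"
      "\<And>x y. x \<in> cball (c p) e \<inter> half_space \<Longrightarrow> y \<in> cball (c p) e \<inter> half_space \<Longrightarrow>
        l * norm (x - y) \<le> norm (Y U c x - Y U c y)"
      using bilipschitz_Y[OF Uc(1)] by blast
    define V where "V = {p' \<in> U. c p' \<in> ball (c p) e}"
    have "inj_on \<psi> V"
    proof (rule inj_onI)
      fix a b assume ab: "a \<in> V" "b \<in> V" "\<psi> a = \<psi> b"
      have "c ` U \<subseteq> half_space" using chart_image[OF Uc(1)] openin_imp_subset by blast
      then have "c a \<in> cball (c p) e \<inter> half_space" "c b \<in> cball (c p) e \<inter> half_space"
        using ab by (auto simp: V_def)
      from el(4)[OF this] have "l * norm (c a - c b) \<le> 0"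
        using ab Y_chart[OF Uc(1), of a] Y_chart[OF Uc(1), of b] by (simp add: V_def)
      then have "c a = c b" using el(2) by (simp add: mult_le_0_iff)
      then show "a = b" using inj_chart[OF Uc(1)] ab by (auto simp: V_def dest: inj_onD)
    qed
    moreover have "openin M V" unfolding V_def by (rule openin_chart_preimage[OF Uc(1) open_ball])
    moreover have "p \<in> V" using Uc el(1) by (simp add: V_def)
    ultimately show "\<exists>V. openin M V \<and> p \<in> V \<and> inj_on \<psi> V" by blast
  qed
  then show "inj_on \<phi> (topspace M)" by (auto simp: inj_on_def)
  have "openin (top_of_set (cball 0 R)) (\<psi> ` topspace M)" using om by (simp add: open_map_def)
  moreover have "closedin (top_of_set (cball 0 R)) (\<psi> ` topspace M)"
  proof -
    have "compact (\<psi> ` topspace M)"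
      using image_compactin[OF _ cont] M(1) by (simp add: compact_space_def)
    then show ?thesis using \<psi>B by (simp add: closed_subset compact_imp_closed)
  qed
  moreover have "\<psi> ` topspace M \<noteq> {}" using M(3) by blast
  ultimately have surj: "\<psi> ` topspace M = cball 0 R"
    using connected_cball[of "0 :: real ^ 'n" R] unfolding connected_clopen by blast
  show "\<phi> ` topspace M = {(x, y). y = t \<and> norm x \<le> R}"
  proof (intro set_eqI iffI)
    fix w :: "(real ^ 'n) \<times> real" assume "w \<in> \<phi> ` topspace M"
    then show "w \<in> {(x, y). y = t \<and> norm x \<le> R}" using height norm_le by (auto simp: case_prod_unfold)
  next
    fix w :: "(real ^ 'n) \<times> real" assume w: "w \<in> {(x, y). y = t \<and> norm x \<le> R}"
    then have "fst w \<in> \<psi> ` topspace M" using surj by (auto simp: case_prod_unfold)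
    then obtain p where p: "p \<in> topspace M" "fst w = \<psi> p" by blast
    have "w = \<phi> p" using w p height[OF p(1)] by (intro prod_eqI) (auto simp: case_prod_unfold)
    then show "w \<in> \<phi> ` topspace M" using p by blast
  qed
  show "manifold_boundary A \<noteq> {}"
  proof -
    have "R *\<^sub>R axis bd_coord 1 \<in> \<psi> ` topspace M" using surj R by (simp)
    then obtain p where p: "p \<in> topspace M" "R *\<^sub>R axis bd_coord 1 = \<psi> p" by blast
    then have np: "norm (\<psi> p) = R" using R by (metis abs_of_pos norm_axis_1 norm_scaleR mult.right_neutral)
    obtain U c where Uc: "(U, c) \<in> A" "p \<in> U" using p(1) by (rule covered)
    have cp: "c p \<in> c ` U" using Uc by blast
    have "\<not> 0 < c p $ bd_coord" using Y_interior[OF Uc(1) cp] Y_chart[OF Uc] np by auto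
    moreover have "c p \<in> half_space" using chart_image[OF Uc(1)] cp openin_imp_subset by blast
    ultimately have "c p $ bd_coord = 0" by (simp add: half_space_def)
    then show ?thesis using Uc by (auto simp: manifold_boundary_def)
  qed
qed

end

section \<open>The classification\<close>

theorem theorem5:
  fixes f :: "real \<Rightarrow> real" and I J :: "real set"
    and M :: "'m topology" and A :: "('m, 'n::finite) chart set"
    and \<phi> :: "'m \<Rightarrow> (real ^ 'n) \<times> real"
  assumes "is_interval I" and "interior I \<noteq> {}"
    and "smooth_on I f" and "\<forall>y\<in>I. 0 < f y"
    and "is_interval J" and "J \<subseteq> I"
    and "\<forall>y\<in>J. 0 \<le> vector_derivative f (at y within I)"
    and "smooth_manifold_with_boundary M A"
    and "topspace M \<noteq> {}" and "compact_space M" and "connected_space M"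
    and "smooth_immersion A \<phi>"
    and "\<phi> ` topspace M \<subseteq> revolution_piece f J"
    and "\<phi> ` manifold_boundary A \<subseteq> revolution_surface f J"
    and "minimal_immersion A \<phi>"
    and "free_boundary f I A \<phi>"
  shows "\<exists>t\<in>J. inj_on \<phi> (topspace M) \<and>
      \<phi> ` topspace M = {(x, y). y = t \<and> norm x \<le> f t} \<and>
      (\<forall>p\<in>manifold_boundary A. snd (\<phi> p) = t) \<and>
      vector_derivative f (at t within I) = 0"
proof -
  interpret immersed_manifold M A \<phi> using assms(8,12) by unfold_locales
  define f' where "f' y = vector_derivative f (at y within I)" for y
  have bdM: "p \<in> topspace M" if "p \<in> manifold_boundary A" for p
    using that chart_domain_subset by (auto simp: manifold_boundary_def)
  \<comment> \<open>The gradient of the defining function is \<open>(2x, -2 f f')\<close>, so its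
    height component has the sign of \<open>- f'\<close>. The gradient is nonzero because boundary
    points satisfy \<open>|x| = f > 0\<close>; this keeps the normalising quotient
    meaningful.\<close>
  have normal: "snd (domain_unit_normal f I (\<phi> p)) =
      - 2 * f (snd (\<phi> p)) * f' (snd (\<phi> p)) / norm (gradient_within (defining_function f) (UNIV \<times> I) (\<phi> p))"
    and normal_nz: "gradient_within (defining_function f) (UNIV \<times> I) (\<phi> p) \<noteq> 0"
    and inJ: "snd (\<phi> p) \<in> J" and bdnorm: "norm (fst (\<phi> p)) = f (snd (\<phi> p))"
    if p: "p \<in> manifold_boundary A" for p
  proof -
    show "snd (\<phi> p) \<in> J" "norm (fst (\<phi> p)) = f (snd (\<phi> p))"
      using p assms(14) by (auto simp: revolution_surface_def case_prod_unfold)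
    then have I: "snd (\<phi> p) \<in> I" and nz: "fst (\<phi> p) \<noteq> 0" using assms(4,6) by force+
    have "gradient_within (defining_function f) (UNIV \<times> I) (fst (\<phi> p), snd (\<phi> p)) =
        (2 *\<^sub>R fst (\<phi> p), - 2 * f (snd (\<phi> p)) * f' (snd (\<phi> p)))"
      unfolding f'_def by (rule gradient_defining_function[OF assms(1-3) I])
    then have grad: "gradient_within (defining_function f) (UNIV \<times> I) (\<phi> p) =
        (2 *\<^sub>R fst (\<phi> p), - 2 * f (snd (\<phi> p)) * f' (snd (\<phi> p)))" by simp
    show "snd (domain_unit_normal f I (\<phi> p)) =
      - 2 * f (snd (\<phi> p)) * f' (snd (\<phi> p)) / norm (gradient_within (defining_function f) (UNIV \<times> I) (\<phi> p))"
      by (simp add: domain_unit_normal_def Let_def grad divide_inverse mult.commute)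
    show "gradient_within (defining_function f) (UNIV \<times> I) (\<phi> p) \<noteq> 0"
      unfolding grad using nz by (simp add: zero_prod_def)
  qed
  have conormal: "is_outward_unit_conormal A \<phi> p (domain_unit_normal f I (\<phi> p))"
    if "p \<in> manifold_boundary A" for p
    using assms(16) that by (simp add: free_boundary_def)
  obtain t where t: "\<And>p. p \<in> topspace M \<Longrightarrow> \<phi> p \<bullet> (0, 1) = t"
  proof (rule linear_function_constant[OF assms(8,12,15,10,11,9), of "(0, 1)"])
    fix p assume p: "p \<in> manifold_boundary A"
    have "0 \<le> f (snd (\<phi> p)) * f' (snd (\<phi> p))"
      using inJ[OF p] assms(4,6,7) by (intro mult_nonneg_nonneg) (auto simp: f'_def less_imp_le)
    then have "snd (domain_unit_normal f I (\<phi> p)) \<le> 0"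
      unfolding normal[OF p] by (simp add: divide_le_0_iff)
    then show "\<exists>\<eta>. is_outward_unit_conormal A \<phi> p \<eta> \<and> \<eta> \<bullet> (0, 1) \<le> 0"
      using conormal[OF p] by (intro exI[of _ "domain_unit_normal f I (\<phi> p)"]) (simp add: inner_prod_def)
  qed blast
  have height: "snd (\<phi> p) = t" if "p \<in> topspace M" for p
    using t[OF that] by (simp add: inner_prod_def)
  have piece: "snd (\<phi> p) \<in> J" "norm (fst (\<phi> p)) \<le> f (snd (\<phi> p))" if "p \<in> topspace M" for p
    using that assms(13) by (auto simp: revolution_piece_def case_prod_unfold)
  obtain q where "q \<in> topspace M" using assms(9) by blast
  then have tJ: "t \<in> J" using piece(1) height by metis
  then have ft: "f t > 0" using assms(4,6) by blast
  interpret flat_immersion M A \<phi> t "f t"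
    using height piece ft bdnorm bdM by unfold_locales auto
  note disk = image_is_disk[OF assms(10,11,9)]
  obtain p where p: "p \<in> manifold_boundary A" using disk(3) by blast
  obtain U c v where Uc: "(U, c) \<in> A" "p \<in> U"
    and v: "domain_unit_normal f I (\<phi> p) = chart_differential \<phi> (U, c) p v"
    using conormal[OF p] unfolding is_outward_unit_conormal_def by blast
  \<comment> \<open>The conormal is a tangent vector, and tangent vectors have no height component
    since the height is constant on the chart.\<close>
  have "snd (chart_differential \<phi> (U, c) p v) = 0"
  proof -
    interpret P: immersed_patch "c ` U" "local_param \<phi> (U, c)" by (rule immersed_patch[OF Uc(1)])
    have cp: "c p \<in> c ` U" using Uc by blast
    have "((\<lambda>u. snd (local_param \<phi> (U, c) u)) has_derivative (\<lambda>v. snd (P.DX (c p) v))) (at (c p) within c ` U)"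
      by (rule has_derivative_snd[OF P.has_derivative_X[OF cp]])
    moreover have "((\<lambda>u. snd (local_param \<phi> (U, c) u)) has_derivative (\<lambda>v. 0)) (at (c p) within c ` U)"
    proof (rule has_derivative_transform[OF cp _ has_derivative_const[of t]])
      show "snd (local_param \<phi> (U, c) u) = t" if "u \<in> c ` U" for u
        using that local_param_chart[OF Uc(1)] height chart_domain_subset[OF Uc(1)] by auto
    qed
    \<comment> \<open>At a boundary point a step along the \<open>bd_coord\<close> axis must have
      \<open>d > 0\<close> to stay in the half-space; such steps along all axes give uniqueness of
      the derivative within the chart image.\<close>
    moreover have "\<exists>d. 0 < \<bar>d\<bar> \<and> \<bar>d\<bar> < e \<and> c p + d *\<^sub>R i \<in> c ` U" if i: "i \<in> Basis" and e: "0 < e" for i e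
    proof -
      obtain e0 where e0: "e0 > 0" "ball (c p) e0 \<inter> half_space \<subseteq> c ` U"
        using chart_image[OF Uc(1)] cp unfolding openin_contains_ball by blast
      obtain k where k: "i = axis k 1" using i by (auto simp: Basis_vec_def)
      define d where "d = min e e0 / 2"
      have d: "0 < d" "d < e" "d < e0" using e e0 by (auto simp: d_def)
      have "c p \<in> half_space" using cp chart_image[OF Uc(1)] openin_imp_subset by blast
      then have "c p + d *\<^sub>R i \<in> half_space" using d(1) by (simp add: half_space_def k axis_def)
      moreover have "c p + d *\<^sub>R i \<in> ball (c p) e0" using d i by (simp add: dist_norm)
      ultimately show ?thesis using d e0(2) by (intro exI[of _ d]) auto
    qed
    ultimately have "(\<lambda>v. snd (P.DX (c p) v)) = (\<lambda>v. 0)"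
      by (rule frechet_derivative_unique_within)
    then show ?thesis by (simp add: chart_differential_def) metis
  qed
  \<comment> \<open>The height component is a quotient by the norm of the gradient;
    \<open>normal_nz\<close> lets its vanishing be read off the numerator.\<close>
  then have "f t * f' t = 0" using v normal[OF p] normal_nz[OF p] height[OF bdM[OF p]] by simp
  then have "f' t = 0" using ft by simp
  then show ?thesis using tJ disk height bdM unfolding f'_def by blast
qed

end
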